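(* Let $V$ be an $n$-dimensional real vector space, and let $K\subset V$ and $T\subset V^*$ be smooth convex bodies, with the origin of $V^*$ in the interior of $T$. Let $\xi_T(K)$ denote the length of the shortest closed billiard trajectory in $K$ with norm $\|\cdot\|_T$, that is, the minimum of $\ell_T(Q)$ over all closed billiard trajectories $Q$ in $K$ with respect to $\|\cdot\|_T$. Then \[ \xi_T(K) = \min_{m\ge 1}\ \min_{P\in \mathcal P_m(K)} \ell_T(P). \] Moreover, the minimum on the right-hand side is attained at some $m\le n+1$.
   Context: A convex body is a compact convex set with non-empty interior; it is smooth if it has a unique support hyperplane at every boundary point. Norm. For a convex body $T\subset V^*$ with the origin in its interior, $\|v\|_T=\max_{p\in T}\langle p,v\rangle$ for $v\in V$. This is the (possibly asymmetric) norm on $V$ whose unit ball is the polar $T^\circ=\{v\in V:\langle p,v\rangle\le 1\ \forall p\in T\}$; note that $T$ lies in the dual space. "Possibly asymmetric" means that $\|-v\|_T=\|v\|_T$ is not required. Length. For points $q_1,\dots,q_m\in V$, $\ell_T(q_1,\dots,q_m)=\sum_{i=1}^m\|q_{i+1}-q_i\|_T$, with indices modulo $m$. The set $\mathcal P_m(K)$. It is the set of all $(q_1,\dots,q_m)\in V^m$ such that $\{q_1,\dots,q_m\}$ does not fit into $\alpha K+t$ for any $\alpha\in(0,1)$ and $t\in V$ (equivalently, is not contained in the interior of any translate $K+t$). A minimum over an empty set is $+\infty$. Closed billiard trajectory. For smooth $K$ and $T$, a closed billiard trajectory in $K$ with respect to $\|\cdot\|_T$ is a closed polygonal line with vertices $q_1,\dots,q_m\in\partial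 K$ ($m\ge 2$, indices modulo $m$, $q_i\ne q_{i+1}$) for which there exist momenta $p_1,\dots,p_m\in\partial T$ such that, for every $i$: (1) $\langle p_i,q_i-q_{i-1}\rangle=\|q_i-q_{i-1}\|_T$, i.e. $p_i$ is the momentum corresponding to the velocity $v_i=(q_i-q_{i-1})/\|q_i-q_{i-1}\|_T$ (so $p_i=d\|\cdot\|_T$ at $v_i$ when the norm is differentiable there, and $v_i=d\|\cdot\|_{T^\circ}$ at $p_i$, where $\|\cdot\|_{T^\circ}$ is the norm on $V^*$ with unit ball $T$); (2) the reflection rule $p_{i+1}-p_i=-\lambda_i\, n_K(q_i)$ holds with some $\lambda_i>0$, where $n_K(q_i)\in V^*$ is the outer normal to $K$ at $q_i$, i.e. the linear functional of unit norm (any fixed normalization) with $\max_{q\in K}\langle n_K(q_i),q\rangle=\langle n_K(q_i),q_i\rangle$. *)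

theory Defs
  imports "HOL-Analysis.Analysis" "HOL-Library.Extended_Real"
begin

text \<open>
  The space \<open>V\<close> is a type \<open>'a\<close> of class \<open>euclidean_space\<close>, its dual is the type
  \<open>'a \<Rightarrow>\<^sub>L real\<close> of (bounded) linear functionals. The inner product of \<open>'a\<close> is never used;
  its norm serves only to provide the standard topology and the normalization of outer normals.
\<close>

definition convex_body :: "'b::real_normed_vector set \<Rightarrow> bool" where
  "convex_body K \<longleftrightarrow> compact K \<and> convex K \<and> interior K \<noteq> {}"

definition support_hyperplane :: "'b::real_normed_vector set \<Rightarrow> 'b \<Rightarrow> 'b set \<Rightarrow> bool" where
  "support_hyperplane K x H \<longleftrightarrow>
     (\<exists>(f :: 'b \<Rightarrow>\<^sub>L real) c. f \<noteq> 0 \<and> H = {y. blinfun_apply f y = c} \<and> x \<in> H \<and>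
        (\<forall>y\<in>K. blinfun_apply f y \<le> c))"

definition smooth_convex_body :: "'b::real_normed_vector set \<Rightarrow> bool" where
  "smooth_convex_body K \<longleftrightarrow>
     convex_body K \<and> (\<forall>x\<in>frontier K. \<exists>!H. support_hyperplane K x H)"

text \<open>For \<open>T\<close> compact and nonempty, the supremum is a maximum.\<close>

definition norm_T :: "('a::euclidean_space \<Rightarrow>\<^sub>L real) set \<Rightarrow> 'a \<Rightarrow> real" where
  "norm_T T v = (SUP p\<in>T. blinfun_apply p v)"

text \<open>
  An \<open>m\<close>-tuple is a list of length \<open>m\<close>, indexed from \<open>0\<close>; \<open>cyc\<close> reads its entries modulo \<open>m\<close>.
\<close>

definition cyc :: "'b list \<Rightarrow> nat \<Rightarrow> 'b" where
  "cyc xs i = xs ! (i mod length xs)"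

definition length_T :: "('a::euclidean_space \<Rightarrow>\<^sub>L real) set \<Rightarrow> 'a list \<Rightarrow> real" where
  "length_T T q = (\<Sum>i<length q. norm_T T (cyc q (i + 1) - cyc q i))"

definition P_set :: "nat \<Rightarrow> 'a::euclidean_space set \<Rightarrow> 'a list set" where
  "P_set m K =
     {q. length q = m \<and>
         \<not> (\<exists>\<alpha>::real. \<exists>t. 0 < \<alpha> \<and> \<alpha> < 1 \<and> set q \<subseteq> (\<lambda>x. \<alpha> *\<^sub>R x + t) ` K)}"

text \<open>If \<open>K\<close> is smooth and \<open>x\<close> lies on its boundary, there is exactly one such \<open>n\<close>.\<close>

definition is_outer_normal ::
    "'a::euclidean_space set \<Rightarrow> 'a \<Rightarrow> ('a \<Rightarrow>\<^sub>L real) \<Rightarrow> bool" where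
  "is_outer_normal K x n \<longleftrightarrow>
     norm n = 1 \<and> (\<forall>y\<in>K. blinfun_apply n y \<le> blinfun_apply n x)"

text \<open>
  Indices are cyclic, so the relation between \<open>p\<^sub>i\<close> and \<open>q\<^sub>i - q\<^sub>i\<^sub>-\<^sub>1\<close> is stated with \<open>i + 1\<close> in
  place of \<open>i\<close>, which avoids subtraction on the natural numbers.
\<close>

definition closed_billiard_trajectory ::
    "'a::euclidean_space set \<Rightarrow> ('a \<Rightarrow>\<^sub>L real) set \<Rightarrow> 'a list \<Rightarrow> bool" where
  "closed_billiard_trajectory K T q \<longleftrightarrow>
     2 \<le> length q \<and> set q \<subseteq> frontier K \<and> (\<forall>i. cyc q i \<noteq> cyc q (i + 1)) \<and>
     (\<exists>p. length p = length q \<and> set p \<subseteq> frontier T \<and>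
        (\<forall>i. blinfun_apply (cyc p (i + 1)) (cyc q (i + 1) - cyc q i)
               = norm_T T (cyc q (i + 1) - cyc q i)) \<and>
        (\<forall>i. \<exists>l n. 0 < l \<and> is_outer_normal K (cyc q i) n \<and>
               cyc p (i + 1) - cyc p i = - (l *\<^sub>R n)))"

text \<open>The infima are extended reals, so that the infimum over an empty set is \<open>\<infinity>\<close>.\<close>

definition xi :: "('a::euclidean_space \<Rightarrow>\<^sub>L real) set \<Rightarrow> 'a set \<Rightarrow> ereal" where
  "xi T K = (INF Q\<in>{Q. closed_billiard_trajectory K T Q}. ereal (length_T T Q))"

definition min_length :: "('a::euclidean_space \<Rightarrow>\<^sub>L real) set \<Rightarrow> 'a set \<Rightarrow> nat \<Rightarrow> ereal" where
  "min_length T K m = (INF P\<in>P_set m K. ereal (length_T T P))"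

end

theory Submission
  imports Defs
begin

text \<open>
  Say that a set of points fits if a translate of the interior of \<open>K\<close> contains it; the tuples
  in \<open>P_set\<close> are those that do not fit.  The proof rests on a duality
  (\<open>certificate_if_not_fits\<close>, \<open>not_fits_if_certificate\<close>): at most \<open>DIM('a) + 1\<close> points \<open>q i\<close>
  do not fit if and only if there are functionals \<open>f i\<close>, not all zero, with sum zero and
  \<open>(\<Sum>i. f i \<bullet> k i) \<le> (\<Sum>i. f i \<bullet> q i)\<close> for all \<open>k i\<close> in \<open>K\<close>.

  A closed billiard trajectory does not fit, because the changes of its momentum are multiples of
  normals of \<open>K\<close> and add up to zero, so they form a certificate
  (\<open>billiard_trajectory_not_fits\<close>).  Hence no trajectory is shorter than the shortest polygon
  that does not fit.

  Conversely, a shortest polygon that does not fit is, up to translation, a trajectory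
  (\<open>translate_of_shortest_is_billiard_trajectory\<close>).  By Helly's theorem and the triangle inequality
  \<open>DIM('a) + 1\<close> vertices suffice, and by compactness the minimum is attained; take a minimizer
  \<open>q\<close> with the fewest vertices.  It lies in a translate of \<open>K\<close>, so the certificate consists of
  outer normals at its vertices, none of them zero.  All polygons that satisfy the linear inequality
  \<open>(\<Sum>i. f i \<bullet> q i) \<le> (\<Sum>i. f i \<bullet> g i)\<close> do not fit either, so \<open>q\<close> minimizes the length, a
  convex function, on a half-space of the space of polygons.  The Lagrange multiplier rule
  (\<open>lagrange_multiplier_momenta\<close>) yields momenta, one for each edge, whose jump at vertex \<open>i\<close> is a
  common negative multiple of \<open>f i\<close>: this is the reflection rule.

  Both the duality and the multiplier rule are separation theorems in the space of tuples of
  vectors.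
\<close>

section \<open>Separation in spaces of tuples\<close>

text \<open>
  Tuples of at most \<open>DIM('a) + 1\<close> vectors are to be separated by functionals, so they have to be
  elements of a single Euclidean space.  The index type \<open>'a vertex_index\<close> with \<open>DIM('a) + 1\<close>
  elements makes \<open>'a ^ 'a vertex_index\<close> such a space; a tuple with fewer entries is filled up
  with zeros.
\<close>

typedef (overloaded) ('a::euclidean_space) vertex_index = "{..DIM('a)}"
  by auto

instance vertex_index :: (euclidean_space) finite
proof
  have "(UNIV :: 'a vertex_index set) = Abs_vertex_index ` {..DIM('a)}"
    by (metis type_definition.Abs_image type_definition_vertex_index)
  then show "finite (UNIV :: 'a vertex_index set)"
    by (metis finite_atMost finite_imageI)
qed

definition tuple_vec :: "nat \<Rightarrow> (nat \<Rightarrow> 'a::euclidean_space) \<Rightarrow> 'a ^ 'a vertex_index" where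
  "tuple_vec m g = (\<chi> i. if Rep_vertex_index i < m then g (Rep_vertex_index i) else 0)"

lemma inner_tuple_vec:
  fixes g :: "nat \<Rightarrow> 'a::euclidean_space"
  assumes "m \<le> DIM('a) + 1"
  shows "tuple_vec m g \<bullet> z = (\<Sum>j<m. g j \<bullet> z $ Abs_vertex_index j)"
proof -
  have "tuple_vec m g \<bullet> z
      = (\<Sum>i\<in>UNIV. if Rep_vertex_index i < m then g (Rep_vertex_index i) \<bullet> z $ i else 0)"
    by (auto simp: inner_vec_def tuple_vec_def intro!: sum.cong)
  also have "\<dots> = (\<Sum>i\<in>{i. Rep_vertex_index i < m}. g (Rep_vertex_index i) \<bullet> z $ i)"
    by (simp add: sum.If_cases)
  also have "\<dots> = (\<Sum>j<m. g j \<bullet> z $ Abs_vertex_index j)"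
  proof (rule sum.reindex_bij_witness[where i = Abs_vertex_index and j = Rep_vertex_index])
    fix j assume "j \<in> {..<m}"
    then have "j \<in> {..DIM('a)}"
      using assms by auto
    then have "Rep_vertex_index (Abs_vertex_index j :: 'a vertex_index) = j"
      by (rule Abs_vertex_index_inverse)
    then show "Rep_vertex_index (Abs_vertex_index j :: 'a vertex_index) = j"
      and "(Abs_vertex_index j :: 'a vertex_index) \<in> {i. Rep_vertex_index i < m}"
      using \<open>j \<in> {..<m}\<close> by auto
  qed (auto simp: Rep_vertex_index_inverse)
  finally show ?thesis .
qed

lemma tuple_vec_nth:
  fixes g :: "nat \<Rightarrow> 'a::euclidean_space"
  assumes "m \<le> DIM('a) + 1" "j < m"
  shows "tuple_vec m g $ Abs_vertex_index j = g j"
  using assms by (simp add: tuple_vec_def Abs_vertex_index_inverse)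

text \<open>
  Separation of several convex sets at once.  Consider the tuples \<open>z\<close> for which one vector \<open>t\<close>
  moves every \<open>z i\<close> into \<open>S i\<close>.  They form a convex set that contains \<open>0\<close> exactly when the sets
  have a common point, so a nonzero functional \<open>(f i)\<close> is nonnegative on it.  The set is invariant
  under simultaneous translation of all entries, and this forces the \<open>f i\<close> to sum to zero.
\<close>

lemma disjoint_convex_family_functionals:
  fixes S :: "nat \<Rightarrow> 'a::euclidean_space set"
  assumes m: "m \<le> DIM('a) + 1"
    and cvx: "\<And>i. i < m \<Longrightarrow> convex (S i)"
    and ne: "\<And>i. i < m \<Longrightarrow> S i \<noteq> {}"
    and disj: "\<not> (\<exists>t. \<forall>i<m. t \<in> S i)"
  shows "\<exists>f. (\<Sum>i<m. f i) = 0 \<and> (\<exists>i<m. f i \<noteq> 0) \<and>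
           (\<forall>s. (\<forall>i<m. s i \<in> S i) \<longrightarrow> 0 \<le> (\<Sum>i<m. f i \<bullet> s i))"
proof -
  define W :: "('a ^ 'a vertex_index) set" where
    "W = {z. \<exists>t. \<forall>i<m. z $ Abs_vertex_index i + t \<in> S i}"
  have "convex W"
  proof (rule convexI)
    fix x y :: "'a ^ 'a vertex_index" and u v :: real
    assume xy: "x \<in> W" "y \<in> W" and uv: "0 \<le> u" "0 \<le> v" "u + v = 1"
    from xy obtain s t where s: "\<forall>i<m. x $ Abs_vertex_index i + s \<in> S i"
      and t: "\<forall>i<m. y $ Abs_vertex_index i + t \<in> S i"
      unfolding W_def by blast
    have "(u *\<^sub>R x + v *\<^sub>R y) $ Abs_vertex_index i + (u *\<^sub>R s + v *\<^sub>R t) \<in> S i" if "i < m" for i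
    proof -
      have "u *\<^sub>R (x $ Abs_vertex_index i + s) + v *\<^sub>R (y $ Abs_vertex_index i + t) \<in> S i"
        using convexD[OF cvx[OF that]] s t that uv by blast
      then show ?thesis
        by (simp add: algebra_simps)
    qed
    then show "u *\<^sub>R x + v *\<^sub>R y \<in> W"
      unfolding W_def by blast
  qed
  moreover have "0 \<notin> W"
    using disj by (auto simp: W_def)
  ultimately obtain a where "a \<noteq> 0" and a: "\<And>z. z \<in> W \<Longrightarrow> 0 \<le> a \<bullet> z"
    using separating_hyperplane_set_0[of W] by blast
  obtain s0 where s0: "\<And>i. i < m \<Longrightarrow> s0 i \<in> S i"
    using choice[of "\<lambda>i x. i < m \<longrightarrow> x \<in> S i"] ne by blast
  have s_W: "tuple_vec m s \<in> W" if "\<And>i. i < m \<Longrightarrow> s i \<in> S i" for s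
    unfolding W_def using that m by (auto simp: tuple_vec_nth intro!: exI[of _ 0])
  \<comment> \<open>A functional that is bounded below on a line is constant on it.\<close>
  have const: "a \<bullet> w = 0" if w: "\<And>c. tuple_vec m s0 + c *\<^sub>R w \<in> W" for w
  proof (rule ccontr)
    assume "a \<bullet> w \<noteq> 0"
    moreover have "0 \<le> a \<bullet> tuple_vec m s0 + c * (a \<bullet> w)" for c
      using a[OF w[of c]] by (simp add: inner_add_right)
    from this[of "- (a \<bullet> tuple_vec m s0 + 1) / (a \<bullet> w)"] show False
      using \<open>a \<bullet> w \<noteq> 0\<close> by (simp add: field_simps)
  qed
  define f where "f i = a $ Abs_vertex_index i" for i
  \<comment> \<open>Entries of index \<open>m\<close> and beyond are unconstrained in \<open>W\<close>, hence ignored by \<open>a\<close>.\<close>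
  have a_pad: "a $ i = 0" if "\<not> Rep_vertex_index i < m" for i
  proof -
    have "(axis i (a $ i)) $ Abs_vertex_index j = 0" if "j < m" for j
      using \<open>\<not> Rep_vertex_index i < m\<close> \<open>j < m\<close> m
      by (auto simp: axis_def Abs_vertex_index_inverse)
    then have "tuple_vec m s0 + c *\<^sub>R axis i (a $ i) \<in> W" for c
      unfolding W_def using s0 m by (auto simp: tuple_vec_nth intro!: exI[of _ 0])
    from const[OF this] show ?thesis
      by (simp add: inner_axis)
  qed
  have a_f: "a = tuple_vec m f"
    unfolding vec_eq_iff tuple_vec_def f_def
    by (auto simp: a_pad Rep_vertex_index_inverse)
  have "(\<Sum>i<m. f i) = 0"
  proof -
    define t where "t = (\<Sum>i<m. f i)"
    have "tuple_vec m s0 + c *\<^sub>R tuple_vec m (\<lambda>i. t) \<in> W" for c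
      unfolding W_def using s0 m by (auto simp: tuple_vec_nth intro!: exI[of _ "- c *\<^sub>R t"])
    from const[OF this] have "(\<Sum>i<m. f i \<bullet> t) = 0"
      using m by (simp add: a_f inner_tuple_vec tuple_vec_nth)
    then show ?thesis
      by (simp add: t_def flip: inner_sum_left)
  qed
  moreover have "\<exists>i<m. f i \<noteq> 0"
    using \<open>a \<noteq> 0\<close> unfolding a_f tuple_vec_def by (auto simp: vec_eq_iff split: if_splits)
  moreover have "0 \<le> (\<Sum>i<m. f i \<bullet> s i)" if "\<forall>i<m. s i \<in> S i" for s
    using a[OF s_W] that m by (simp add: a_f inner_tuple_vec tuple_vec_nth)
  ultimately show ?thesis
    by blast
qed

text \<open>
  The Lagrange multiplier rule for minimizing \<open>\<lambda>x. SUP a\<in>A. a \<bullet> x\<close>, whose minimum is \<open>L\<close>, over the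
  half-space of the points \<open>x\<close> with \<open>f \<bullet> q \<le> f \<bullet> x\<close>: at a minimizer \<open>q\<close>, some nonnegative multiple
  of \<open>f\<close> is a subgradient.  The subgradients at \<open>q\<close> are the points of the face
  \<open>{a \<in> A. a \<bullet> q = L}\<close>.  If this face missed the ray spanned by \<open>f\<close>, a direction \<open>d\<close> separating
  the two would stay in the half-space and decrease the supremum.
\<close>

lemma lagrange_multiplier_sup_of_linear:
  fixes A :: "'e::euclidean_space set"
  assumes A: "compact A" "convex A" and "f \<noteq> 0"
    and le: "\<And>a. a \<in> A \<Longrightarrow> a \<bullet> q \<le> L"
    and ge: "\<And>d. 0 \<le> f \<bullet> d \<Longrightarrow> \<exists>a\<in>A. L \<le> a \<bullet> (q + d)"
  shows "\<exists>c\<ge>0. c *\<^sub>R f \<in> A \<and> (c *\<^sub>R f) \<bullet> q = L"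
proof (rule ccontr)
  assume contra: "\<not> ?thesis"
  define F where "F = A \<inter> {a. a \<bullet> q = L}"
  define R where "R = {z. z = ((z \<bullet> f) / (f \<bullet> f)) *\<^sub>R f \<and> 0 \<le> z \<bullet> f}"
  have R_eq: "z \<in> R \<longleftrightarrow> (\<exists>c\<ge>0. z = c *\<^sub>R f)" for z
  proof
    assume "z \<in> R"
    then show "\<exists>c\<ge>0. z = c *\<^sub>R f"
      unfolding R_def by (auto intro!: exI[of _ "(z \<bullet> f) / (f \<bullet> f)"])
  qed (auto simp: R_def \<open>f \<noteq> 0\<close>)
  have "compact F" "convex F"
    unfolding F_def using A
    by (auto intro!: compact_Int_closed closed_Collect_eq continuous_intros convex_Int
        convex_hyperplane[of q, unfolded inner_commute[of q]])
  moreover have "F \<noteq> {}"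
    using ge[of 0] le unfolding F_def by (force intro: antisym)
  moreover have "closed R"
    unfolding R_def
    by (intro closed_Collect_conj closed_Collect_eq closed_Collect_le continuous_intros) (use \<open>f \<noteq> 0\<close> in auto)
  moreover have "convex R"
  proof (rule convexI)
    fix x y u v assume "x \<in> R" "y \<in> R" "0 \<le> (u::real)" "0 \<le> (v::real)"
    then obtain c d where "0 \<le> c" "0 \<le> d" "x = c *\<^sub>R f" "y = d *\<^sub>R f"
      unfolding R_eq by blast
    then have "u *\<^sub>R x + v *\<^sub>R y = (u * c + v * d) *\<^sub>R f" "0 \<le> u * c + v * d"
      using \<open>0 \<le> u\<close> \<open>0 \<le> v\<close> by (auto simp: scaleR_add_left)
    then show "u *\<^sub>R x + v *\<^sub>R y \<in> R"
      unfolding R_eq by blast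
  qed
  moreover have "F \<inter> R = {}"
    using contra unfolding F_def by (blast dest: R_eq[THEN iffD1])
  ultimately obtain d b where d: "\<forall>x\<in>F. d \<bullet> x < b" "\<forall>x\<in>R. d \<bullet> x > b"
    using separating_hyperplane_compact_closed by blast
  have "0 \<in> R"
    by (auto simp: R_eq)
  with d have "b < 0"
    by fastforce
  have fd: "0 \<le> f \<bullet> d"
  proof (rule ccontr)
    assume neg: "\<not> 0 \<le> f \<bullet> d"
    have "(b / (f \<bullet> d)) *\<^sub>R f \<in> R"
      unfolding R_eq using neg \<open>b < 0\<close> by (auto intro!: exI[of _ "b / (f \<bullet> d)"] divide_nonpos_neg)
    with d(2) have "d \<bullet> ((b / (f \<bullet> d)) *\<^sub>R f) > b"
      by blast
    then show False
      using neg by (simp add: inner_commute)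
  qed
  \<comment> \<open>Points of \<open>A\<close> that certify minimality against the steps \<open>e k *\<^sub>R d\<close> have a nonnegative
    product with \<open>d\<close>; in the limit they yield a point of the face with the same property,
    although \<open>d\<close> is negative on the face.\<close>
  define e where "e k = 1 / real (Suc k)" for k
  have e_pos: "0 < e k" for k
    by (simp add: e_def)
  have "\<exists>a\<in>A. L \<le> a \<bullet> (q + e k *\<^sub>R d)" for k
    using ge[of "e k *\<^sub>R d"] fd e_pos[of k] by simp
  then obtain a where aA: "\<And>k. a k \<in> A" and a: "\<And>k. L \<le> a k \<bullet> (q + e k *\<^sub>R d)"
    by metis
  have ad: "0 \<le> a k \<bullet> d" for k
  proof -
    have "0 \<le> e k * (a k \<bullet> d)"
      using a[of k] le[OF aA[of k]] by (simp add: inner_add_right)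
    then show ?thesis
      using e_pos[of k] by (simp add: zero_le_mult_iff)
  qed
  obtain l r where l: "l \<in> A" and r: "strict_mono r" "(a \<circ> r) \<longlonglongrightarrow> l"
    using A(1) aA unfolding compact_def by blast
  have "e \<longlonglongrightarrow> 0"
    unfolding e_def using LIMSEQ_inverse_real_of_nat by (simp add: inverse_eq_divide)
  then have "(e \<circ> r) \<longlonglongrightarrow> 0"
    using r(1) by (rule LIMSEQ_subseq_LIMSEQ)
  then have "(\<lambda>k. (a \<circ> r) k \<bullet> (q + (e \<circ> r) k *\<^sub>R d)) \<longlonglongrightarrow> l \<bullet> (q + 0 *\<^sub>R d)"
    using r(2) by (intro tendsto_intros)
  then have "L \<le> l \<bullet> (q + 0 *\<^sub>R d)"
    by (rule LIMSEQ_le_const) (use a in auto)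
  with le[OF l] l have "l \<in> F"
    by (simp add: F_def)
  have "(\<lambda>k. (a \<circ> r) k \<bullet> d) \<longlonglongrightarrow> l \<bullet> d"
    using r(2) by (intro tendsto_intros)
  then have "0 \<le> l \<bullet> d"
    by (rule LIMSEQ_le_const) (use ad in auto)
  with d(1) \<open>l \<in> F\<close> \<open>b < 0\<close> show False
    by (fastforce simp: inner_commute)
qed

section \<open>The asymmetric norm and the length of closed polygons\<close>

lemma linear_maximizer_in_frontier:
  fixes F :: "'b::real_normed_vector \<Rightarrow> real"
  assumes "linear F" "F u \<noteq> 0" "x \<in> S" and max: "\<And>y. y \<in> S \<Longrightarrow> F y \<le> F x"
  shows "x \<in> frontier S"
proof -
  interpret linear F by fact
  have "x \<notin> interior S"
  proof
    assume "x \<in> interior S"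
    then obtain e where e: "0 < e" "ball x e \<subseteq> S"
      by (auto simp: mem_interior)
    have "u \<noteq> 0"
      using assms(2) by auto
    define y where "y = x + (e / 2 / norm u * sgn (F u)) *\<^sub>R u"
    have "norm ((e / 2 / norm u * sgn (F u)) *\<^sub>R u) = e / 2"
      using \<open>u \<noteq> 0\<close> assms(2) e by (simp add: abs_mult)
    then have "y \<in> ball x e"
      using e by (simp add: y_def dist_norm)
    then have "F y \<le> F x"
      using e max by blast
    moreover have "F y = F x + e / 2 / norm u * \<bar>F u\<bar>"
      unfolding y_def add scale abs_sgn by simp
    ultimately have "e / 2 / norm u * \<bar>F u\<bar> \<le> 0"
      by linarith
    moreover have "0 < e / 2 / norm u * \<bar>F u\<bar>"
      using e \<open>u \<noteq> 0\<close> assms(2) by (intro mult_pos_pos divide_pos_pos) auto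
    ultimately show False
      by linarith
  qed
  then show ?thesis
    using assms(3) closure_subset by (auto simp: frontier_def)
qed

lemma blinfun_eq_inner_left:
  fixes p :: "'a::euclidean_space \<Rightarrow>\<^sub>L real"
  obtains x where "p = blinfun_inner_left x"
proof
  show "p = blinfun_inner_left (\<Sum>b\<in>Basis. blinfun_apply p b *\<^sub>R b)"
  proof (rule blinfun_eqI)
    fix y
    have "blinfun_apply p y = blinfun_apply p (\<Sum>b\<in>Basis. (y \<bullet> b) *\<^sub>R b)"
      by (simp add: euclidean_representation)
    also have "\<dots> = (\<Sum>b\<in>Basis. (y \<bullet> b) * blinfun_apply p b)"
      by (simp add: blinfun.sum_right blinfun.scaleR_right)
    finally show "blinfun_apply p y = blinfun_apply (blinfun_inner_left (\<Sum>b\<in>Basis. blinfun_apply p b *\<^sub>R b)) y"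
      by (simp add: inner_sum_right mult.commute)
  qed
qed

lemma norm_le_norm_blinfun_inner_left:
  fixes x :: "'a::real_inner"
  shows "norm x \<le> norm (blinfun_inner_left x)"
proof (cases "x = 0")
  case False
  have "norm x * norm x \<le> norm (blinfun_inner_left x) * norm x"
    using norm_blinfun[of "blinfun_inner_left x" x] by (simp add: dot_square_norm power2_eq_square)
  then show ?thesis
    using False by simp
qed simp

locale momentum_body =
  fixes T :: "('a::euclidean_space \<Rightarrow>\<^sub>L real) set"
  assumes compact: "compact T" and convex: "convex T" and zero_interior: "0 \<in> interior T"
begin

lemma T_nonempty: "T \<noteq> {}"
  using zero_interior interior_subset by blast

lemma compact_values: "compact ((\<lambda>p. blinfun_apply p v) ` T)"
  by (intro compact_continuous_image continuous_intros compact)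

lemma norm_T_ge: "p \<in> T \<Longrightarrow> blinfun_apply p v \<le> norm_T T v"
  unfolding norm_T_def
  by (rule cSUP_upper) (simp_all add: bounded_imp_bdd_above[OF compact_imp_bounded[OF compact_values]])

lemma norm_T_attained: "\<exists>p\<in>T. blinfun_apply p v = norm_T T v"
proof -
  obtain p where p: "p \<in> T" "\<And>r. r \<in> T \<Longrightarrow> blinfun_apply r v \<le> blinfun_apply p v"
    using compact_attains_sup[OF compact_values[of v]] T_nonempty by auto
  have "norm_T T v \<le> blinfun_apply p v"
    unfolding norm_T_def using p T_nonempty by (intro cSUP_least) auto
  with p(1) norm_T_ge[OF p(1), of v] show ?thesis
    by (intro bexI[of _ p]) auto
qed

lemma norm_T_triangle: "norm_T T (v + w) \<le> norm_T T v + norm_T T w"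
proof -
  obtain p where "p \<in> T" "blinfun_apply p (v + w) = norm_T T (v + w)"
    using norm_T_attained by blast
  then show ?thesis
    using norm_T_ge[of p v] norm_T_ge[of p w] by (simp add: blinfun.add_right)
qed

lemma norm_T_scaleR:
  assumes "0 \<le> s"
  shows "norm_T T (s *\<^sub>R v) = s * norm_T T v"
proof (rule antisym)
  obtain p where "p \<in> T" "blinfun_apply p (s *\<^sub>R v) = norm_T T (s *\<^sub>R v)"
    using norm_T_attained by blast
  then show "norm_T T (s *\<^sub>R v) \<le> s * norm_T T v"
    using mult_left_mono[OF norm_T_ge[of p v] assms] by (simp add: blinfun.scaleR_right)
next
  obtain p where "p \<in> T" "blinfun_apply p v = norm_T T v"
    using norm_T_attained by blast
  then show "s * norm_T T v \<le> norm_T T (s *\<^sub>R v)"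
    using norm_T_ge[of p "s *\<^sub>R v"] by (simp add: blinfun.scaleR_right)
qed

lemma norm_T_zero [simp]: "norm_T T 0 = 0"
  using norm_T_scaleR[of 0 0] by simp

lemma norm_T_lower_bound: "\<exists>c>0. \<forall>v. c * norm v \<le> norm_T T v"
proof -
  obtain e where e: "0 < e" "ball 0 e \<subseteq> T"
    using zero_interior by (auto simp: mem_interior)
  have bound: "e / 2 * norm v \<le> norm_T T v" for v
  proof (cases "v = 0")
    case False
    define p where "p = (e / 2 / norm v) *\<^sub>R blinfun_inner_left v"
    have "norm (blinfun_inner_left v) \<le> norm v"
      by (rule norm_blinfun_bound) (auto simp: Cauchy_Schwarz_ineq2 mult.commute)
    then have "norm p \<le> e / 2"
      using False e by (simp add: p_def field_simps)
    then have "p \<in> T"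
      using e by (auto simp: subset_eq)
    from norm_T_ge[OF this, of v] show ?thesis
      using False by (simp add: p_def blinfun.scaleR_left dot_square_norm power2_eq_square)
  qed simp
  show ?thesis
    using e(1) bound by (intro exI[of _ "e / 2"]) auto
qed

lemma norm_T_nonneg: "0 \<le> norm_T T v"
  using norm_T_ge[of 0 v] zero_interior interior_subset by auto

lemma norm_T_pos: "v \<noteq> 0 \<Longrightarrow> 0 < norm_T T v"
  using norm_T_lower_bound by (metis mult_pos_pos order_less_le_trans zero_less_norm_iff)

lemma norm_T_triangle_diff: "norm_T T (z - x) \<le> norm_T T (y - x) + norm_T T (z - y)"
  using norm_T_triangle[of "y - x" "z - y"] by simp

lemma continuous_on_norm_T: "continuous_on UNIV (norm_T T)"
proof (rule convex_on_continuous[OF open_UNIV])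
  show "convex_on UNIV (norm_T T)"
  proof (rule convex_onI)
    fix t :: real and x y :: 'a
    assume "0 < t" "t < 1"
    then show "norm_T T ((1 - t) *\<^sub>R x + t *\<^sub>R y) \<le> (1 - t) * norm_T T x + t * norm_T T y"
      using norm_T_triangle[of "(1 - t) *\<^sub>R x" "t *\<^sub>R y"] by (simp add: norm_T_scaleR)
  qed simp
qed

text \<open>
  The length of the closed polygon with the vertices \<open>g 0, \<dots>, g (m - 1)\<close>.  Sequences of
  vertices are more convenient than lists for compactness and duality arguments; lists are
  more convenient for the removal of vertices.
\<close>

definition polygon_length :: "nat \<Rightarrow> (nat \<Rightarrow> 'a) \<Rightarrow> real" where
  "polygon_length m g = (\<Sum>i<m. norm_T T (g (Suc i mod m) - g i))"

lemma length_T_eq_polygon_length: "length_T T q = polygon_length (length q) ((!) q)"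
  by (simp add: length_T_def polygon_length_def cyc_def)

lemma polygon_length_cong: "(\<And>i. i < m \<Longrightarrow> g i = h i) \<Longrightarrow> polygon_length m g = polygon_length m h"
  unfolding polygon_length_def by (intro sum.cong) auto

lemma length_T_map: "length_T T (map g [0..<m]) = polygon_length m g"
  unfolding length_T_eq_polygon_length length_map length_upt
  by simp (rule polygon_length_cong, simp)

lemma polygon_length_translate: "polygon_length m (\<lambda>i. g i - t) = polygon_length m g"
  by (simp add: polygon_length_def)

lemma polygon_length_scaleR: "0 \<le> s \<Longrightarrow> polygon_length m (\<lambda>i. s *\<^sub>R g i) = s * polygon_length m g"
  by (simp add: polygon_length_def norm_T_scaleR sum_distrib_left flip: scaleR_diff_right)

lemma polygon_length_pos:
  assumes "i < m" "g (Suc i mod m) \<noteq> g i"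
  shows "0 < polygon_length m g"
  unfolding polygon_length_def
  using assms by (intro sum_pos2[of _ i]) (auto simp: norm_T_nonneg norm_T_pos)

text \<open>
  A bound on the length confines all vertices to a ball around the first one; this is where
  the origin being interior to \<open>T\<close> matters for compactness.
\<close>

lemma polygon_diameter_bound:
  "\<exists>c>0. \<forall>m g i. i < m \<longrightarrow> c * norm (g i - g 0) \<le> polygon_length m g"
proof -
  obtain c where c: "0 < c" "\<And>v. c * norm v \<le> norm_T T v"
    using norm_T_lower_bound by blast
  have "c * norm (g i - g 0) \<le> polygon_length m g" if "i < m" for m i and g :: "nat \<Rightarrow> 'a"
  proof -
    have "norm_T T (g i - g 0) \<le> (\<Sum>j<i. norm_T T (g (Suc j) - g j))"
    proof (induction i)
      case (Suc i)
      then show ?case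
        using norm_T_triangle_diff[of "g (Suc i)" "g 0" "g i"] by simp
    qed simp
    also have "\<dots> = (\<Sum>j<i. norm_T T (g (Suc j mod m) - g j))"
      using that by (intro sum.cong) auto
    also have "\<dots> \<le> polygon_length m g"
      unfolding polygon_length_def using that by (intro sum_mono2) (auto simp: norm_T_nonneg)
    finally show ?thesis
      using c(2)[of "g i - g 0"] by linarith
  qed
  with c(1) show ?thesis
    by (intro exI[of _ c]) simp
qed

fun path_length :: "'a list \<Rightarrow> real" where
  "path_length (x # y # zs) = norm_T T (y - x) + path_length (y # zs)"
| "path_length _ = 0"

lemma path_length_eq_sum: "path_length xs = (\<Sum>i<length xs - 1. norm_T T (xs ! Suc i - xs ! i))"
  by (induction xs rule: path_length.induct) (auto simp: sum.lessThan_Suc_shift simp del: sum.lessThan_Suc)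

lemma length_T_Cons: "length_T T (x # xs) = path_length (x # xs @ [x])"
proof -
  have "(x # xs) ! (Suc i mod Suc (length xs)) = (x # xs @ [x]) ! Suc i"
    if "i < Suc (length xs)" for i
    using that by (cases "i = length xs") (simp_all add: nth_append)
  moreover have "(x # xs) ! i = (x # xs @ [x]) ! i" if "i < Suc (length xs)" for i
    using that by (cases i) (simp_all add: nth_append)
  ultimately show ?thesis
    unfolding length_T_eq_polygon_length polygon_length_def path_length_eq_sum
    by (intro sum.cong) simp_all
qed

lemma path_length_append:
  "xs \<noteq> [] \<Longrightarrow> path_length (xs @ [y]) = path_length xs + norm_T T (y - last xs)"
  by (induction xs rule: path_length.induct) auto

lemma path_length_remove: "path_length (xs @ ys) \<le> path_length (xs @ x # ys)"
proof (induction xs)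
  case Nil
  show ?case
    by (cases ys) (auto simp: norm_T_nonneg)
next
  case (Cons a xs)
  show ?case
  proof (cases xs)
    case Nil
    then show ?thesis
      using norm_T_triangle_diff norm_T_nonneg by (cases ys) auto
  next
    case (Cons b xs')
    then show ?thesis
      using Cons.IH by simp
  qed
qed

text \<open>
  Removing a vertex is a shortcut.  If the removed vertex is the first one, the closed path is
  cut at a different place, so this case needs an argument of its own.
\<close>

lemma length_T_remove: "length_T T (xs @ ys) \<le> length_T T (xs @ x # ys)"
proof (cases xs)
  case (Cons a xs')
  then show ?thesis
    using path_length_remove[of "a # xs'" "ys @ [a]" x] by (simp add: length_T_Cons)
next
  case Nil
  show ?thesis
  proof (cases ys)
    case Nil
    then show ?thesis
      using \<open>xs = []\<close> by (simp add: length_T_Cons norm_T_nonneg) (simp add: length_T_def)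
  next
    case (Cons y zs)
    have "path_length (y # zs @ [y]) \<le> norm_T T (y - x) + path_length (y # zs @ [x])"
      using path_length_append[of "y # zs" x] path_length_append[of "y # zs" y]
        norm_T_triangle_diff[of y "last (y # zs)" x]
      by simp
    then show ?thesis
      using \<open>xs = []\<close> Cons by (simp add: length_T_Cons)
  qed
qed

end

section \<open>Polygons that do not fit into a smaller copy of a convex body\<close>

text \<open>
  Demanding the interior of a translate instead of a smaller homothetic copy makes the condition
  open in the points, and it says that reflected translates of a convex set, one for each point,
  have a vector \<open>t\<close> in common.
\<close>

definition fits :: "'a::euclidean_space set \<Rightarrow> 'a set \<Rightarrow> bool" where
  "fits K X \<longleftrightarrow> (\<exists>t. \<forall>x\<in>X. x - t \<in> interior K)"

lemma fits_mono: "fits K Y \<Longrightarrow> X \<subseteq> Y \<Longrightarrow> fits K X"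
  unfolding fits_def by blast

lemma fits_if_scaled_copy:
  assumes "convex K" "interior K \<noteq> {}" "\<alpha> < 1" "0 \<le> \<alpha>" "X \<subseteq> (\<lambda>x. \<alpha> *\<^sub>R x + t) ` K"
  shows "fits K X"
proof -
  obtain c where c: "c \<in> interior K"
    using assms(2) by blast
  have "x - (t - (1 - \<alpha>) *\<^sub>R c) \<in> interior K" if x: "x \<in> X" for x
  proof -
    obtain k where "k \<in> K" "x = \<alpha> *\<^sub>R k + t"
      using x assms(5) by blast
    with mem_interior_convex_shrink[OF assms(1) c, of k "1 - \<alpha>"] assms(3,4)
    show ?thesis
      by (simp add: algebra_simps)
  qed
  then show ?thesis
    unfolding fits_def by blast
qed

text \<open>
  Points in the interior of a translate stay there when they are moved away slightly from an
  interior point \<open>c\<close>, and for finitely many points one factor works for all of them.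
\<close>

lemma scaled_copy_if_fits:
  assumes "finite X" "fits K X" "interior K \<noteq> {}"
  shows "\<exists>\<alpha>::real. \<exists>t. 0 < \<alpha> \<and> \<alpha> < 1 \<and> X \<subseteq> (\<lambda>x. \<alpha> *\<^sub>R x + t) ` K"
proof -
  obtain c where c: "c \<in> interior K"
    using assms(3) by blast
  obtain t where t: "\<forall>x\<in>X. x - t \<in> interior K"
    using assms(2) unfolding fits_def by blast
  have "\<forall>\<^sub>F \<alpha> in at_left (1::real). c + (1 / \<alpha>) *\<^sub>R (x - t - c) \<in> interior K" if "x \<in> X" for x
  proof (rule topological_tendstoD)
    show "((\<lambda>\<alpha>::real. c + (1 / \<alpha>) *\<^sub>R (x - t - c)) \<longlongrightarrow> c + (1 / 1) *\<^sub>R (x - t - c)) (at_left 1)"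
      by (intro tendsto_intros) auto
  qed (use t that in auto)
  then have "\<forall>\<^sub>F \<alpha> in at_left (1::real). \<forall>x\<in>X. c + (1 / \<alpha>) *\<^sub>R (x - t - c) \<in> interior K"
    using assms(1) by (simp add: eventually_ball_finite)
  moreover have "\<forall>\<^sub>F \<alpha> in at_left (1::real). \<alpha> \<in> {0<..<1}"
    by (rule eventually_at_left_real) simp
  ultimately obtain \<alpha> :: real where \<alpha>: "\<forall>x\<in>X. c + (1 / \<alpha>) *\<^sub>R (x - t - c) \<in> interior K" "\<alpha> \<in> {0<..<1}"
    using eventually_happens[OF eventually_conj] by (metis (mono_tags, lifting) trivial_limit_at_left_real)
  have "x \<in> (\<lambda>x. \<alpha> *\<^sub>R x + (t + (1 - \<alpha>) *\<^sub>R c)) ` K" if "x \<in> X" for x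
  proof (rule image_eqI)
    show "x = \<alpha> *\<^sub>R (c + (1 / \<alpha>) *\<^sub>R (x - t - c)) + (t + (1 - \<alpha>) *\<^sub>R c)"
      using \<alpha>(2) by (simp add: algebra_simps)
    show "c + (1 / \<alpha>) *\<^sub>R (x - t - c) \<in> K"
      using \<alpha>(1) that interior_subset by blast
  qed
  then show ?thesis
    using \<alpha>(2) by auto
qed

lemma P_set_iff:
  assumes "convex_body K"
  shows "q \<in> P_set m K \<longleftrightarrow> length q = m \<and> \<not> fits K (set q)"
proof -
  have "convex K" "interior K \<noteq> {}"
    using assms by (auto simp: convex_body_def)
  then have "(\<exists>\<alpha>::real. \<exists>t. 0 < \<alpha> \<and> \<alpha> < 1 \<and> set q \<subseteq> (\<lambda>x. \<alpha> *\<^sub>R x + t) ` K) \<longleftrightarrow> fits K (set q)"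
    using scaled_copy_if_fits[of "set q" K] fits_if_scaled_copy[of K _ "set q"] by fastforce
  then show ?thesis
    unfolding P_set_def by (simp only: mem_Collect_eq)
qed

lemma fits_singleton: "interior K \<noteq> {} \<Longrightarrow> fits K {x}"
  unfolding fits_def by (metis all_not_in_conv diff_diff_eq2 add_diff_cancel_left' singletonD)

lemma length_ge_2_if_not_fits:
  assumes "interior K \<noteq> {}" "\<not> fits K (set q)"
  shows "2 \<le> length q"
proof -
  have "q \<noteq> []"
    using assms by (auto simp: fits_def)
  moreover have "q \<noteq> [x]" for x
    using assms fits_singleton[of K x] by auto
  ultimately show ?thesis
    by (cases q; cases "tl q") auto
qed

lemma convex_point_minus:
  assumes "convex (S :: 'a::real_vector set)"
  shows "convex ((\<lambda>k. x - k) ` S)"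
proof -
  have "(\<lambda>k. x - k) ` S = (+) x ` uminus ` S"
    by (simp add: image_image)
  then show ?thesis
    using assms by (simp add: convex_translation convex_negations)
qed

text \<open>
  Helly's theorem for the sets of admissible translations \<open>{t. x - t \<in> interior K}\<close>, one for each
  vertex \<open>x\<close>: if all of them have empty intersection, so do some \<open>DIM('a) + 1\<close> of them.
\<close>

lemma removable_vertex:
  fixes K :: "'a::euclidean_space set"
  assumes "convex K" "\<not> fits K (set q)" and len: "DIM('a) + 2 \<le> length q"
  shows "\<exists>xs x ys. q = xs @ x # ys \<and> \<not> fits K (set (xs @ ys))"
proof (rule ccontr)
  assume contra: "\<not> ?thesis"
  have rem: "fits K (set (xs @ ys))" if "q = xs @ x # ys" for xs x ys
    using contra that by blast
  have "distinct q"
  proof (rule ccontr)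
    assume "\<not> distinct q"
    then obtain xs ys zs y where q: "q = xs @ [y] @ ys @ [y] @ zs"
      using not_distinct_decomp by blast
    have "fits K (set (xs @ ys @ [y] @ zs))"
      using rem[of xs y "ys @ [y] @ zs"] q by simp
    moreover have "set (xs @ ys @ [y] @ zs) = set q"
      using q by auto
    ultimately show False
      using assms(2) by simp
  qed
  define S where "S x = {t. x - t \<in> interior K}" for x
  have S_inter: "\<Inter> (S ` X) \<noteq> {} \<longleftrightarrow> fits K X" for X
    by (auto simp: S_def fits_def)
  have S_convex: "convex (S x)" for x
  proof -
    have "S x = (\<lambda>k. x - k) ` interior K"
      by (force simp: S_def image_iff)
    then show ?thesis
      using convex_point_minus[OF convex_interior[OF assms(1)]] by simp
  qed
  have small: "fits K B" if "B \<subseteq> set q" "card B \<le> DIM('a) + 1" for B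
  proof -
    have "card B < card (set q)"
      using that len \<open>distinct q\<close> by (simp add: distinct_card)
    then have "\<not> set q \<subseteq> B"
      using that(1) by (metis card_mono finite_set finite_subset linorder_not_less)
    then obtain x where "x \<in> set q" "x \<notin> B"
      by blast
    then obtain xs ys where q: "q = xs @ x # ys"
      by (meson split_list)
    have "B \<subseteq> set (xs @ ys)"
      using that(1) \<open>x \<notin> B\<close> q by auto
    then show ?thesis
      using rem[OF q] fits_mono by blast
  qed
  have "\<Inter> (S ` set q) \<noteq> {}"
  proof (cases "card (S ` set q) \<ge> DIM('a) + 1")
    case True
    then show ?thesis
    proof (rule Helly)
      fix t assume t: "t \<subseteq> S ` set q" "card t = DIM('a) + 1"
      then obtain B where B: "B \<subseteq> set q" "inj_on S B" "t = S ` B"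
        by (metis subset_image_inj)
      then have "card B = DIM('a) + 1"
        using t(2) by (simp add: card_image)
      then show "\<Inter> t \<noteq> {}"
        using small[of B] B S_inter by simp
    qed (auto simp: S_convex)
  next
    case False
    obtain B where "B \<subseteq> set q" "inj_on S B" "S ` set q = S ` B"
      by (metis subset_image_inj order_refl)
    then show ?thesis
      using False small[of B] S_inter by (simp add: card_image)
  qed
  then show False
    using S_inter assms(2) by simp
qed

text \<open>
  The next two lemmas are a theorem of the alternative.  That \<open>q\<close> does not fit means that the
  sets \<open>q i - interior K\<close> have no common point \<open>t\<close>; functionals \<open>f i\<close> that are separating in the
  sense of \<open>disjoint_convex_family_functionals\<close> certify this, and every certificate shows that
  \<open>q\<close> does not fit.  The certificate is a single inequality linear in \<open>q\<close>.
\<close>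

lemma certificate_if_not_fits:
  fixes q :: "nat \<Rightarrow> 'a::euclidean_space"
  assumes K: "convex K" "interior K \<noteq> {}" and m: "m \<le> DIM('a) + 1"
    and unfit: "\<not> fits K (q ` {..<m})"
  shows "\<exists>f. (\<Sum>i<m. f i) = 0 \<and> (\<exists>i<m. f i \<noteq> 0) \<and>
           (\<forall>k. (\<forall>i<m. k i \<in> K) \<longrightarrow> (\<Sum>i<m. f i \<bullet> k i) \<le> (\<Sum>i<m. f i \<bullet> q i))"
proof -
  obtain c where c: "c \<in> interior K"
    using K(2) by blast
  have "convex ((\<lambda>k. q i - k) ` interior K)" for i
    by (rule convex_point_minus[OF convex_interior[OF K(1)]])
  moreover have "\<not> (\<exists>t. \<forall>i<m. t \<in> (\<lambda>k. q i - k) ` interior K)"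
  proof
    assume "\<exists>t. \<forall>i<m. t \<in> (\<lambda>k. q i - k) ` interior K"
    then obtain t where t: "\<And>i. i < m \<Longrightarrow> t \<in> (\<lambda>k. q i - k) ` interior K"
      by blast
    have "q i - t \<in> interior K" if "i < m" for i
      using t[OF that] by auto
    then show False
      using unfit unfolding fits_def by blast
  qed
  ultimately obtain f where f: "(\<Sum>i<m. f i) = 0" "\<exists>i<m. f i \<noteq> 0"
    and pos: "\<And>s. (\<And>i. i < m \<Longrightarrow> s i \<in> (\<lambda>k. q i - k) ` interior K) \<Longrightarrow> 0 \<le> (\<Sum>i<m. f i \<bullet> s i)"
    using disjoint_convex_family_functionals[OF m, of "\<lambda>i. (\<lambda>k. q i - k) ` interior K"] K(2) by blast
  have "(\<Sum>i<m. f i \<bullet> k i) \<le> (\<Sum>i<m. f i \<bullet> q i)" if k: "\<forall>i<m. k i \<in> K" for k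
  proof -
    \<comment> \<open>The inequality holds for points of the interior; approach the points of the body
      along segments that end at an interior point.\<close>
    define D where "D e = (\<Sum>i<m. f i \<bullet> (q i - (k i - e *\<^sub>R (k i - c))))" for e
    have D_nonneg: "0 \<le> D e" if "0 < e" "e \<le> 1" for e
      unfolding D_def
      using mem_interior_convex_shrink[OF K(1) c _ that] k by (intro pos imageI) auto
    have "\<forall>\<^sub>F e in at_right 0. 0 \<le> D e"
      by (rule eventually_mono[OF eventually_at_right_real[of 0 1]]) (auto intro: D_nonneg)
    moreover have "(D \<longlongrightarrow> (\<Sum>i<m. f i \<bullet> (q i - (k i - 0 *\<^sub>R (k i - c))))) (at_right 0)"
      unfolding D_def by (intro tendsto_intros)
    ultimately have "0 \<le> (\<Sum>i<m. f i \<bullet> (q i - (k i - 0 *\<^sub>R (k i - c))))"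
      by (intro tendsto_lowerbound) auto
    then show ?thesis
      by (simp add: inner_diff_right sum_subtractf)
  qed
  with f show ?thesis
    by blast
qed

text \<open>
  A translate of \<open>K\<close> with all vertices in its interior would make the sum on the right strictly
  smaller than the maximum of the left side, since \<open>t\<close> cancels by \<open>(\<Sum>i<m. f i) = 0\<close>.  Vertices
  with \<open>f i = 0\<close> do not contribute to this sum, so even the remaining ones do not fit.
\<close>

lemma not_fits_if_certificate:
  fixes q :: "nat \<Rightarrow> 'a::euclidean_space"
  assumes "interior K \<noteq> {}"
    and f: "(\<Sum>i<m. f i) = 0" "\<exists>i<m. f i \<noteq> 0"
    and max: "\<And>k. (\<And>i. i < m \<Longrightarrow> k i \<in> K) \<Longrightarrow> (\<Sum>i<m. f i \<bullet> k i) \<le> (\<Sum>i<m. f i \<bullet> q i)"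
  shows "\<not> fits K (q ` {i. i < m \<and> f i \<noteq> 0})"
proof
  assume "fits K (q ` {i. i < m \<and> f i \<noteq> 0})"
  then obtain t where t: "\<And>i. i < m \<Longrightarrow> f i \<noteq> 0 \<Longrightarrow> q i - t \<in> interior K"
    unfolding fits_def by blast
  have "\<exists>k. k \<in> K \<and> f i \<bullet> (q i - t) \<le> f i \<bullet> k \<and> (f i \<noteq> 0 \<longrightarrow> f i \<bullet> (q i - t) < f i \<bullet> k)"
    if i: "i < m" for i
  proof (cases "f i = 0")
    case True
    then show ?thesis
      using assms(1) interior_subset by auto
  next
    case False
    then obtain e where e: "0 < e" "cball (q i - t) e \<subseteq> K"
      using t[OF i] by (auto simp: mem_interior_cball)
    define k where "k = q i - t + (e / norm (f i)) *\<^sub>R f i"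
    have "k \<in> K"
      using e False by (intro subsetD[OF e(2)]) (simp add: k_def dist_norm)
    moreover have "f i \<bullet> (q i - t) < f i \<bullet> k"
      using e False by (simp add: k_def inner_add_right)
    ultimately show ?thesis
      by (intro exI[of _ k]) simp
  qed
  then obtain k where k: "\<And>i. i < m \<Longrightarrow> k i \<in> K"
    and le: "\<And>i. i < m \<Longrightarrow> f i \<bullet> (q i - t) \<le> f i \<bullet> k i"
    and less: "\<And>i. i < m \<Longrightarrow> f i \<noteq> 0 \<Longrightarrow> f i \<bullet> (q i - t) < f i \<bullet> k i"
    by metis
  have "(\<Sum>i<m. f i \<bullet> (q i - t)) < (\<Sum>i<m. f i \<bullet> k i)"
    using f(2) le less by (intro sum_strict_mono_ex1) auto
  moreover have "(\<Sum>i<m. f i \<bullet> (q i - t)) = (\<Sum>i<m. f i \<bullet> q i)"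
    using f(1) by (simp add: inner_diff_right sum_subtractf flip: inner_sum_left)
  moreover have "(\<Sum>i<m. f i \<bullet> k i) \<le> (\<Sum>i<m. f i \<bullet> q i)"
    using k by (rule max)
  ultimately show False
    by linarith
qed

section \<open>Existence of shortest polygons\<close>

lemma compact_power:
  fixes S :: "'a::topological_space set"
  assumes "compact S"
  shows "compact {g :: 'i \<Rightarrow> 'a. \<forall>i. g i \<in> S}"
proof -
  have "compactin (product_topology (\<lambda>i. euclidean) UNIV) (PiE (UNIV :: 'i set) (\<lambda>i. S))"
    unfolding compactin_PiE using assms by simp
  then show ?thesis
    unfolding euclidean_product_topology compactin_euclidean_iff by (simp add: PiE_def Pi_def)
qed

context momentum_body
begin

lemma shorten_to_dim_plus_one:
  assumes "convex K" "\<not> fits K (set q)"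
  shows "\<exists>q'. \<not> fits K (set q') \<and> length q' \<le> DIM('a) + 1 \<and> length_T T q' \<le> length_T T q"
  using assms(2)
proof (induction "length q" arbitrary: q rule: less_induct)
  case less
  show ?case
  proof (cases "length q \<le> DIM('a) + 1")
    case False
    then obtain xs x ys where q: "q = xs @ x # ys" and "\<not> fits K (set (xs @ ys))"
      using removable_vertex[OF assms(1) less.prems] by auto
    then obtain q' where "\<not> fits K (set q')" "length q' \<le> DIM('a) + 1"
      "length_T T q' \<le> length_T T (xs @ ys)"
      using less.hyps[of "xs @ ys"] by auto
    then show ?thesis
      using length_T_remove[of xs ys x] q by fastforce
  qed (use less.prems in blast)
qed

lemma continuous_on_polygon_length: "continuous_on UNIV (polygon_length m)"
proof -
  have "continuous_on UNIV (\<lambda>g :: nat \<Rightarrow> 'a. norm_T T (g j - g i))" for i j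
    by (rule continuous_on_compose2[OF continuous_on_norm_T continuous_on_diff])
      (rule continuous_on_product_coordinates subset_UNIV)+
  then have "continuous_on UNIV (\<lambda>g. polygon_length m g)"
    unfolding polygon_length_def by (intro continuous_on_sum)
  then show ?thesis
    by simp
qed

text \<open>
  The polygons that do not fit form a closed set in the product topology, because those that fit
  form an open one, and after a translation the competitors lie in a product of compact balls.
\<close>

lemma shortest_polygon_exists:
  assumes "1 \<le> m" and unfit: "\<not> fits K (g0 ` {..<m})"
  shows "\<exists>g. \<not> fits K (g ` {..<m}) \<and>
           (\<forall>g'. \<not> fits K (g' ` {..<m}) \<longrightarrow> polygon_length m g \<le> polygon_length m g')"
proof -
  obtain c where c: "0 < c" "\<And>m g i. i < m \<Longrightarrow> c * norm (g i - g 0) \<le> polygon_length m g"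
    using polygon_diameter_bound by blast
  define r where "r = polygon_length m g0 / c"
  define B where "B = {g :: nat \<Rightarrow> 'a. \<forall>i. g i \<in> cball 0 r}"
  define U where "U = {g. \<not> fits K (g ` {..<m})}"
  have "compact B"
    unfolding B_def by (rule compact_power) simp
  have "open {g. fits K (g ` {..<m})}"
  proof -
    have eq: "{g. fits K (g ` {..<m})} = (\<Union>t. {g. \<forall>i\<in>{..<m}. g i \<in> (+) t ` interior K})"
    proof -
      have "x \<in> (+) t ` interior K \<longleftrightarrow> x - t \<in> interior K" for x t
        by (auto intro!: image_eqI[of _ _ "x - t"])
      then show ?thesis
        by (auto simp: fits_def)
    qed
    have "open {g :: nat \<Rightarrow> 'a. \<forall>i\<in>{..<m}. g i \<in> (+) t ` interior K}" for t
      by (rule product_topology_basis'[of "{..<m}" "\<lambda>i. (+) t ` interior K" "\<lambda>i. i"])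
        (rule finite_lessThan open_translation open_interior)+
    then show ?thesis
      unfolding eq by (intro open_UN ballI)
  qed
  then have "closed U"
    by (simp add: U_def closed_def Compl_eq)
  \<comment> \<open>Moving the first vertex to the origin and zeroing the entries beyond the last vertex
    brings a polygon that is not longer than the given one into the compact set.\<close>
  have norm_form: "\<exists>h\<in>B \<inter> U. polygon_length m h = polygon_length m g"
    if "g \<in> U" "polygon_length m g \<le> polygon_length m g0" for g
  proof
    define h where "h i = (if i < m then g i - g 0 else 0)" for i
    have "polygon_length m h = polygon_length m (\<lambda>i. g i - g 0)"
      by (rule polygon_length_cong) (simp add: h_def)
    then show "polygon_length m h = polygon_length m g"
      by (simp add: polygon_length_translate)
    have "0 \<le> r"
      using c(1) c(2)[of 0 m g0] assms(1) by (simp add: r_def)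
    moreover have "norm (g i - g 0) \<le> r" if "i < m" for i
    proof -
      have "c * norm (g i - g 0) \<le> polygon_length m g0"
        using c(2)[OF that, of g] \<open>polygon_length m g \<le> polygon_length m g0\<close> by linarith
      then show ?thesis
        using c(1) by (simp add: r_def field_simps)
    qed
    ultimately have "h \<in> B"
      by (simp add: B_def h_def)
    moreover have "h \<in> U"
    proof -
      have "fits K (g ` {..<m})" if h: "fits K (h ` {..<m})"
      proof -
        obtain t where "\<forall>i<m. h i - t \<in> interior K"
          using h by (auto simp: fits_def)
        then have "\<forall>i<m. g i - (g 0 + t) \<in> interior K"
          by (simp add: h_def diff_diff_eq)
        then show ?thesis
          unfolding fits_def by blast
      qed
      then show ?thesis
        using \<open>g \<in> U\<close> by (auto simp: U_def)
    qed
    ultimately show "h \<in> B \<inter> U"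
      by blast
  qed
  have "compact (B \<inter> U)"
    using \<open>compact B\<close> \<open>closed U\<close> by (rule compact_Int_closed)
  moreover have "B \<inter> U \<noteq> {}"
    using norm_form[of g0] unfit by (auto simp: U_def)
  moreover have "continuous_on (B \<inter> U) (polygon_length m)"
    using continuous_on_polygon_length continuous_on_subset by blast
  ultimately obtain g where g: "g \<in> B \<inter> U" "\<And>h. h \<in> B \<inter> U \<Longrightarrow> polygon_length m g \<le> polygon_length m h"
    by (meson continuous_attains_inf)
  obtain h0 where "h0 \<in> B \<inter> U" "polygon_length m h0 = polygon_length m g0"
    using norm_form[of g0] unfit by (auto simp: U_def)
  then have g_g0: "polygon_length m g \<le> polygon_length m g0"
    using g(2) by metis
  have "polygon_length m g \<le> polygon_length m g'" if "\<not> fits K (g' ` {..<m})" for g'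
  proof (cases "polygon_length m g' \<le> polygon_length m g0")
    case True
    then show ?thesis
      using norm_form[of g'] that g(2) by (metis U_def mem_Collect_eq)
  qed (use g_g0 in linarith)
  then show ?thesis
    using g(1) by (auto simp: U_def)
qed

end

section \<open>Momenta as Lagrange multipliers\<close>

lemma sum_cyclic_shift:
  fixes F :: "nat \<Rightarrow> 'b::comm_monoid_add"
  shows "(\<Sum>i<m. F (Suc i mod m)) = (\<Sum>i<m. F i)"
proof (cases m)
  case (Suc k)
  have "(\<Sum>i<m. F (Suc i mod m)) = (\<Sum>i<k. F (Suc i)) + F 0"
    unfolding Suc by simp
  also have "\<dots> = (\<Sum>i<m. F i)"
    unfolding Suc by (simp add: sum.lessThan_Suc_shift add.commute del: sum.lessThan_Suc)
  finally show ?thesis .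
qed simp

text \<open>
  Cyclic summation by parts.  It exchanges the sum over edges (momentum times edge vector) for
  the sum over vertices (negative jump of the momentum times vertex).
\<close>

lemma sum_inner_cyclic_differences:
  fixes x g :: "nat \<Rightarrow> 'a::real_inner"
  shows "(\<Sum>i<m. (x i - x (Suc i mod m)) \<bullet> g i)
       = (\<Sum>i<m. x (Suc i mod m) \<bullet> (g (Suc i mod m) - g i))"
  using sum_cyclic_shift[of "\<lambda>i. x i \<bullet> g i" m]
  by (simp add: inner_diff_left inner_diff_right sum_subtractf)

lemma cyclic_predecessor: "i < m \<Longrightarrow> (Suc i mod m + m - 1) mod m = i"
  by (cases "Suc i = m") auto

lemma cyc_eq_nth: "i < length q \<Longrightarrow> cyc q i = q ! i"
  by (simp add: cyc_def)

lemma cyc_mod: "cyc q (i mod length q) = cyc q i"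
  by (simp add: cyc_def)

lemma set_eq_nth_image: "set q = (!) q ` {..<length q}"
  by (auto simp: set_conv_nth)

context momentum_body
begin

text \<open>
  The multiplier rule for the length of polygons.  Summation by parts shows that the length of a
  polygon is the maximum of its product with the tuples \<open>(x i - x (Suc i mod m))\<close> of negative
  momentum jumps, where the \<open>x i\<close> range over \<open>T\<close>.  These tuples form a compact convex set, so the rule
  for suprema of linear functionals applies: the tuple \<open>f\<close> is, up to a factor, a tuple of
  negative momentum jumps, and the momenta \<open>p i\<close> that realize it attain the length of \<open>q\<close>, which
  is only possible if each of them attains the length of its own edge.
\<close>

lemma lagrange_multiplier_momenta:
  fixes q f :: "nat \<Rightarrow> 'a"
  assumes m: "m \<le> DIM('a) + 1" and f: "\<exists>i<m. f i \<noteq> 0"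
    and min: "\<And>g. (\<Sum>i<m. f i \<bullet> q i) \<le> (\<Sum>i<m. f i \<bullet> g i) \<Longrightarrow>
                polygon_length m q \<le> polygon_length m g"
  shows "\<exists>c p. 0 \<le> c \<and> c * (\<Sum>i<m. f i \<bullet> q i) = polygon_length m q \<and> (\<forall>i. p i \<in> T) \<and>
           (\<forall>i<m. p (Suc i mod m) - p i = - (c *\<^sub>R blinfun_inner_left (f i))) \<and>
           (\<forall>i<m. blinfun_apply (p (Suc i mod m)) (q (Suc i mod m) - q i)
                  = norm_T T (q (Suc i mod m) - q i))"
proof -
  \<comment> \<open>\<open>S\<close> is \<open>T\<close> with functionals represented by vectors.\<close>
  define S where "S = {x :: 'a. blinfun_inner_left x \<in> T}"
  define jump where "jump x = tuple_vec m (\<lambda>i. x i - x (Suc i mod m))" for x :: "nat \<Rightarrow> 'a"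
  define A where "A = jump ` {x. \<forall>i. x i \<in> S}"
  have S_norm_T: "x \<bullet> v \<le> norm_T T v" if "x \<in> S" for x v
    using norm_T_ge[of "blinfun_inner_left x" v] that by (simp add: S_def inner_commute)
  have "compact S"
    unfolding compact_eq_bounded_closed
  proof
    obtain b where b: "\<And>p. p \<in> T \<Longrightarrow> norm p \<le> b"
      using compact_imp_bounded[OF compact] unfolding bounded_iff by blast
    have "norm x \<le> b" if "x \<in> S" for x
      using norm_le_norm_blinfun_inner_left[of x] b[of "blinfun_inner_left x"] that
      by (simp add: S_def)
    then show "bounded S"
      unfolding bounded_iff by blast
    have "closed (blinfun_inner_left -` T :: 'a set)"
      by (intro continuous_closed_vimage compact_imp_closed[OF compact]
          linear_continuous_at bounded_linear_blinfun_inner_left)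
    then show "closed S"
      by (simp add: S_def vimage_def)
  qed
  have A_compact: "compact A"
    unfolding A_def
  proof (rule compact_continuous_image[OF _ compact_power[OF \<open>compact S\<close>]])
    have "continuous_on UNIV (\<lambda>x :: nat \<Rightarrow> 'a.
        if Rep_vertex_index i < m
        then x (Rep_vertex_index i) - x (Suc (Rep_vertex_index i) mod m) else 0)"
      for i :: "'a vertex_index"
      by (cases "Rep_vertex_index i < m")
        (simp_all only: if_True if_False continuous_on_diff continuous_on_product_coordinates
          continuous_on_const)
    then have "continuous_on UNIV jump"
      unfolding jump_def tuple_vec_def by (intro continuous_on_vec_lambda)
    then show "continuous_on {x. \<forall>i. x i \<in> S} jump"
      using continuous_on_subset by blast
  qed
  have A_convex: "convex A"
  proof (rule convexI)
    fix a b and u v :: real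
    assume "a \<in> A" "b \<in> A" and uv: "0 \<le> u" "0 \<le> v" "u + v = 1"
    then obtain x y where xy: "a = jump x" "b = jump y" "\<And>i. x i \<in> S" "\<And>i. y i \<in> S"
      unfolding A_def by blast
    have "u *\<^sub>R a + v *\<^sub>R b = jump (\<lambda>i. u *\<^sub>R x i + v *\<^sub>R y i)"
      by (simp add: xy jump_def tuple_vec_def vec_eq_iff algebra_simps)
    moreover have "u *\<^sub>R x i + v *\<^sub>R y i \<in> S" for i
      using convexD[OF convex, of "blinfun_inner_left (x i)" "blinfun_inner_left (y i)" u v] xy uv
      by (simp add: S_def linear_add linear_scale bounded_linear.linear
          bounded_linear_blinfun_inner_left)
    ultimately show "u *\<^sub>R a + v *\<^sub>R b \<in> A"
      unfolding A_def by blast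
  qed
  have f_nz: "tuple_vec m f \<noteq> 0"
    using f m tuple_vec_nth[of m _ f] by (metis zero_index)
  have inner_jump: "jump x \<bullet> z = (\<Sum>i<m. x (Suc i mod m) \<bullet>
      (z $ Abs_vertex_index (Suc i mod m) - z $ Abs_vertex_index i))" for x z
    unfolding jump_def inner_tuple_vec[OF m] by (rule sum_inner_cyclic_differences)
  have inner_jump_tuple: "jump x \<bullet> tuple_vec m g
      = (\<Sum>i<m. x (Suc i mod m) \<bullet> (g (Suc i mod m) - g i))" for x g
    unfolding inner_jump using m by (intro sum.cong) (auto simp: tuple_vec_nth)
  have A_le: "a \<bullet> tuple_vec m q \<le> polygon_length m q" if a: "a \<in> A" for a
  proof -
    obtain x where "a = jump x" "\<And>i. x i \<in> S"
      using a unfolding A_def by blast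
    then show ?thesis
      by (simp add: inner_jump_tuple polygon_length_def S_norm_T sum_mono)
  qed
  have A_ge: "\<exists>a\<in>A. polygon_length m q \<le> a \<bullet> (tuple_vec m q + d)"
    if d: "0 \<le> tuple_vec m f \<bullet> d" for d
  proof -
    define g where "g i = q i + d $ Abs_vertex_index i" for i
    have "polygon_length m q \<le> polygon_length m g"
      using d by (intro min) (simp add: g_def inner_add_right sum.distrib inner_tuple_vec[OF m])
    have "\<exists>x. x \<in> S \<and> x \<bullet> v = norm_T T v" for v
    proof -
      obtain p where "p \<in> T" "blinfun_apply p v = norm_T T v"
        using norm_T_attained by blast
      then show ?thesis
        by (cases p rule: blinfun_eq_inner_left) (auto simp: S_def inner_commute)
    qed
    then obtain M where M: "\<And>v. M v \<in> S" "\<And>v. M v \<bullet> v = norm_T T v"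
      by metis
    \<comment> \<open>The momentum with index \<open>j\<close> belongs to the edge that ends at vertex \<open>j\<close>.\<close>
    define x where "x j = M (g j - g ((j + m - 1) mod m))" for j
    have "jump x \<bullet> (tuple_vec m q + d) = (\<Sum>i<m. x (Suc i mod m) \<bullet> (g (Suc i mod m) - g i))"
      unfolding inner_jump using m by (intro sum.cong) (auto simp: tuple_vec_nth g_def)
    also have "\<dots> = polygon_length m g"
      unfolding polygon_length_def x_def
      by (intro sum.cong) (simp_all add: cyclic_predecessor M(2) del: One_nat_def)
    finally have "polygon_length m q \<le> jump x \<bullet> (tuple_vec m q + d)"
      using \<open>polygon_length m q \<le> polygon_length m g\<close> by simp
    moreover have "jump x \<in> A"
      unfolding A_def by (auto simp: x_def M(1))
    ultimately show ?thesis
      by blast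
  qed
  obtain c where c: "0 \<le> c" "c *\<^sub>R tuple_vec m f \<in> A"
    "(c *\<^sub>R tuple_vec m f) \<bullet> tuple_vec m q = polygon_length m q"
    using lagrange_multiplier_sup_of_linear[OF A_compact A_convex f_nz A_le A_ge] by auto
  then obtain x where x: "c *\<^sub>R tuple_vec m f = jump x" "\<And>i. x i \<in> S"
    unfolding A_def by blast
  have cf: "c *\<^sub>R f i = x i - x (Suc i mod m)" if "i < m" for i
    using arg_cong[OF x(1), of "\<lambda>z. z $ Abs_vertex_index i"] that m
    by (simp add: jump_def tuple_vec_nth)
  have "c * (\<Sum>i<m. f i \<bullet> q i) = polygon_length m q"
    using c(3) m by (simp add: inner_tuple_vec tuple_vec_nth)
  moreover have "x (Suc i mod m) \<bullet> (q (Suc i mod m) - q i) = norm_T T (q (Suc i mod m) - q i)"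
    if "i < m" for i
  proof -
    have "(\<Sum>i<m. norm_T T (q (Suc i mod m) - q i) - x (Suc i mod m) \<bullet> (q (Suc i mod m) - q i)) = 0"
      using c(3) unfolding x(1) inner_jump_tuple polygon_length_def by (simp add: sum_subtractf)
    then have "\<forall>i\<in>{..<m}. norm_T T (q (Suc i mod m) - q i) - x (Suc i mod m) \<bullet> (q (Suc i mod m) - q i) = 0"
      by (subst (asm) sum_nonneg_eq_0_iff) (auto simp: S_norm_T x(2))
    then show ?thesis
      using that by simp
  qed
  moreover have "blinfun_inner_left (x (Suc i mod m)) - blinfun_inner_left (x i)
      = - (c *\<^sub>R blinfun_inner_left (f i))" if "i < m" for i
  proof (rule blinfun_eqI)
    fix y
    show "blinfun_apply (blinfun_inner_left (x (Suc i mod m)) - blinfun_inner_left (x i)) y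
      = blinfun_apply (- (c *\<^sub>R blinfun_inner_left (f i))) y"
      using arg_cong[OF cf[OF that], of "\<lambda>z. y \<bullet> z"]
      by (simp add: blinfun.diff_left blinfun.minus_left blinfun.scaleR_left inner_diff_right)
  qed
  ultimately show ?thesis
    using c(1) x(2)
    by (intro exI[of _ c] exI[of _ "\<lambda>i. blinfun_inner_left (x i)"]) (auto simp: S_def inner_commute)
qed

end

text \<open>
  Around a closed trajectory the jumps of the momentum add up to zero.  By the reflection rule
  they are negative multiples of outer normals, which therefore form a certificate.
\<close>

lemma billiard_trajectory_not_fits:
  fixes K :: "'a::euclidean_space set"
  assumes "interior K \<noteq> {}" and traj: "closed_billiard_trajectory K T q"
  shows "\<not> fits K (set q)"
proof -
  define m where "m = length q"
  have m: "2 \<le> m"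
    using traj by (simp add: closed_billiard_trajectory_def m_def)
  from traj obtain p where "length p = m"
    and p: "\<And>i. \<exists>l n. 0 < l \<and> is_outer_normal K (cyc q i) n \<and> cyc p (i + 1) - cyc p i = - (l *\<^sub>R n)"
    unfolding closed_billiard_trajectory_def m_def by blast
  have "\<exists>u. u \<noteq> 0 \<and> (\<forall>y\<in>K. u \<bullet> y \<le> u \<bullet> cyc q i) \<and> cyc p (i + 1) - cyc p i = - blinfun_inner_left u" for i
  proof -
    obtain l n where ln: "0 < l" "is_outer_normal K (cyc q i) n" "cyc p (i + 1) - cyc p i = - (l *\<^sub>R n)"
      using p by blast
    obtain u where u: "l *\<^sub>R n = blinfun_inner_left u"
      by (rule blinfun_eq_inner_left)
    have u_apply: "u \<bullet> y = l * blinfun_apply n y" for y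
      using arg_cong[OF u, of "\<lambda>F. blinfun_apply F y"] by (simp add: blinfun.scaleR_left inner_commute)
    have "u \<noteq> 0"
    proof
      assume "u = 0"
      then have "n = 0"
        using u_apply ln(1) by (intro blinfun_eqI) simp
      then show False
        using ln(2) by (simp add: is_outer_normal_def)
    qed
    then show ?thesis
      using ln u u_apply by (intro exI[of _ u]) (simp add: is_outer_normal_def)
  qed
  then obtain f where f: "\<And>i. f i \<noteq> 0" "\<And>i y. y \<in> K \<Longrightarrow> f i \<bullet> y \<le> f i \<bullet> cyc q i"
    "\<And>i. cyc p (i + 1) - cyc p i = - blinfun_inner_left (f i)"
    by metis
  have "(\<Sum>i<m. cyc p (Suc i mod m)) = (\<Sum>i<m. cyc p i)"
    by (rule sum_cyclic_shift)
  then have "(\<Sum>i<m. cyc p (i + 1) - cyc p i) = 0"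
    using \<open>length p = m\<close> cyc_mod[of p] by (simp add: sum_subtractf)
  then have "(\<Sum>i<m. blinfun_inner_left (f i)) = 0"
    unfolding f(3) by (simp add: sum_negf)
  moreover have "blinfun_inner_left (\<Sum>i<m. f i) = (\<Sum>i<m. blinfun_inner_left (f i))"
    by (rule linear_sum) (rule bounded_linear.linear[OF bounded_linear_blinfun_inner_left])
  ultimately have "(\<Sum>i<m. f i) = 0"
    using norm_le_norm_blinfun_inner_left[of "\<Sum>i<m. f i"] by simp
  moreover have "\<exists>i<m. f i \<noteq> 0"
    using f(1) m by (intro exI[of _ 0]) simp
  ultimately have "\<not> fits K (cyc q ` {i. i < m \<and> f i \<noteq> 0})"
    using assms(1) f(2) by (intro not_fits_if_certificate sum_mono) auto
  moreover have "cyc q ` {i. i < m \<and> f i \<noteq> 0} \<subseteq> set q"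
    by (auto simp: m_def cyc_eq_nth)
  ultimately show ?thesis
    using fits_mono by blast
qed

section \<open>Shortest polygons are billiard trajectories\<close>

lemma bounded_does_not_cover_far_pair:
  fixes K :: "'a::euclidean_space set"
  assumes "bounded K"
  shows "\<exists>v. \<not> fits K {0, v}"
proof -
  obtain r where r: "\<And>x. x \<in> K \<Longrightarrow> norm x \<le> r"
    using assms unfolding bounded_iff by blast
  obtain b :: 'a where b: "b \<in> Basis"
    using nonempty_Basis by blast
  define v where "v = (2 * \<bar>r\<bar> + 1) *\<^sub>R b"
  have False if v_in: "0 - t \<in> K" "v - t \<in> K" for t
  proof -
    have "norm v \<le> norm (v - t) + norm t"
      using norm_triangle_ineq[of "v - t" t] by simp
    also have "\<dots> \<le> 2 * r"
      using r[OF v_in(1)] r[OF v_in(2)] by simp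
    finally show False
      using b by (simp add: v_def)
  qed
  then have "\<not> fits K {0, v}"
    unfolding fits_def using interior_subset by blast
  then show ?thesis ..
qed

context momentum_body
begin

lemma shortest_in_P_set_exists:
  fixes K :: "'a set"
  assumes K: "convex_body K" and ne: "P_set m K \<noteq> {}"
  shows "\<exists>q\<in>P_set m K. \<forall>q'\<in>P_set m K. length_T T q \<le> length_T T q'"
proof -
  obtain q0 where "q0 \<in> P_set m K"
    using ne by blast
  then have q0: "length q0 = m" "\<not> fits K (set q0)"
    by (simp_all add: P_set_iff[OF K])
  have "interior K \<noteq> {}"
    using K by (simp add: convex_body_def)
  with q0 have "1 \<le> m"
    using length_ge_2_if_not_fits[of K q0] by simp
  moreover have "\<not> fits K ((!) q0 ` {..<m})"
    using q0 by (simp add: set_eq_nth_image)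
  ultimately obtain g where g: "\<not> fits K (g ` {..<m})"
    and min: "\<And>g'. \<not> fits K (g' ` {..<m}) \<Longrightarrow> polygon_length m g \<le> polygon_length m g'"
    using shortest_polygon_exists[of m K "(!) q0"] by blast
  have "map g [0..<m] \<in> P_set m K"
    using g by (simp add: P_set_iff[OF K] lessThan_atLeast0)
  moreover have "length_T T (map g [0..<m]) \<le> length_T T q'" if q': "q' \<in> P_set m K" for q'
  proof -
    have "length q' = m" "\<not> fits K ((!) q' ` {..<m})"
      using q' P_set_iff[OF K, of q' m] set_eq_nth_image[of q'] by auto
    then show ?thesis
      using min[of "(!) q'"] by (simp add: length_T_map length_T_eq_polygon_length[of q'])
  qed
  ultimately show ?thesis
    by blast
qed

text \<open>
  Removing vertices reduces the search to the finitely many numbers \<open>m \<le> DIM('a) + 1\<close>.  Among the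
  shortest polygons, one with the fewest vertices has no removable vertex, and this is what
  rules out degenerate trajectories below.
\<close>

lemma shortest_with_fewest_vertices_exists:
  fixes K :: "'a set"
  assumes K: "convex_body K"
  shows "\<exists>q. \<not> fits K (set q) \<and> (\<forall>q'. \<not> fits K (set q') \<longrightarrow> length_T T q \<le> length_T T q') \<and>
           (\<forall>q'. \<not> fits K (set q') \<and> length_T T q' \<le> length_T T q \<longrightarrow> length q \<le> length q')"
proof -
  have "convex K" "bounded K"
    using K by (auto simp: convex_body_def compact_imp_bounded)
  define M where "M = {m. m \<le> DIM('a) + 1 \<and> P_set m K \<noteq> {}}"
  have M_iff: "length q \<in> M \<longleftrightarrow> length q \<le> DIM('a) + 1"
    if "\<not> fits K (set q)" for q :: "'a list"
    using that by (auto simp: M_def P_set_iff[OF K])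
  obtain v :: 'a where v: "\<not> fits K (set [0, v])"
    using bounded_does_not_cover_far_pair[OF \<open>bounded K\<close>] by auto
  have "finite M"
    by (simp add: M_def)
  have "M \<noteq> {}"
    using shorten_to_dim_plus_one[OF \<open>convex K\<close> v] M_iff by blast
  have "\<forall>m\<in>M. \<exists>q\<in>P_set m K. \<forall>q'\<in>P_set m K. length_T T q \<le> length_T T q'"
    using shortest_in_P_set_exists[OF K] by (simp add: M_def)
  then obtain b where b: "\<And>m. m \<in> M \<Longrightarrow> b m \<in> P_set m K"
    "\<And>m q'. m \<in> M \<Longrightarrow> q' \<in> P_set m K \<Longrightarrow> length_T T (b m) \<le> length_T T q'"
    by metis
  define m where "m = arg_min_on (\<lambda>m. length_T T (b m)) M"
  have m: "m \<in> M" "\<And>k. k \<in> M \<Longrightarrow> length_T T (b m) \<le> length_T T (b k)"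
    unfolding m_def using \<open>finite M\<close> \<open>M \<noteq> {}\<close>
    by (rule arg_min_if_finite(1), rule arg_min_least)
  have "length_T T (b m) \<le> length_T T q" if unfit: "\<not> fits K (set q)" for q
  proof -
    obtain q' where q': "\<not> fits K (set q')" "length q' \<le> DIM('a) + 1" "length_T T q' \<le> length_T T q"
      using shorten_to_dim_plus_one[OF \<open>convex K\<close> unfit] by blast
    then have "length q' \<in> M"
      using M_iff by blast
    then have "length_T T (b m) \<le> length_T T (b (length q'))"
      by (rule m(2))
    also have "\<dots> \<le> length_T T q'"
      using \<open>length q' \<in> M\<close> q'(1) by (intro b(2)) (simp_all add: P_set_iff[OF K])
    finally show ?thesis
      using q'(3) by linarith
  qed
  moreover have "\<not> fits K (set (b m))"
    using b(1)[OF m(1)] by (simp add: P_set_iff[OF K])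
  ultimately obtain q where q: "\<not> fits K (set q)"
      "\<And>q'. \<not> fits K (set q') \<Longrightarrow> length_T T q \<le> length_T T q'"
    and least: "\<And>q'. \<not> fits K (set q') \<and> (\<forall>q''. \<not> fits K (set q'') \<longrightarrow> length_T T q' \<le> length_T T q'')
          \<Longrightarrow> length q \<le> length q'"
    using ex_has_least_nat[of "\<lambda>q. \<not> fits K (set q) \<and>
        (\<forall>q'. \<not> fits K (set q') \<longrightarrow> length_T T q \<le> length_T T q')" "b m" length] by blast
  have "length q \<le> length q'" if "\<not> fits K (set q')" "length_T T q' \<le> length_T T q" for q'
    using that q(2) by (intro least) (meson order_trans)
  with q show ?thesis
    by blast
qed

text \<open>
  Copies of a shortest polygon shrunk by a factor \<open>s < 1\<close> are shorter, hence fit; a limit of the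
  translations for \<open>s \<rightarrow> 1\<close> moves the polygon itself into \<open>K\<close>.
\<close>

lemma shortest_fits_in_translate:
  assumes K: "compact K" and unfit_min: "\<And>q'. \<not> fits K (set q') \<Longrightarrow> length_T T q \<le> length_T T q'"
    and "q \<noteq> []" and pos: "0 < length_T T q"
  shows "\<exists>t. \<forall>x\<in>set q. x - t \<in> K"
proof -
  define m where "m = length q"
  have "0 < m"
    using assms(3) by (simp add: m_def)
  define s where "s k = 1 - inverse (real (Suc k))" for k
  have s: "0 \<le> s k" "s k < 1" for k
    by (auto simp: s_def inverse_le_1_iff)
  have "\<exists>\<tau>. \<forall>i<m. s k *\<^sub>R (q ! i) - \<tau> \<in> K" for k
  proof -
    define Q where "Q = map (\<lambda>i. s k *\<^sub>R (q ! i)) [0..<m]"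
    have "length_T T Q = s k * length_T T q"
      using s(1) by (simp add: Q_def length_T_map polygon_length_scaleR length_T_eq_polygon_length[of q] m_def)
    also have "\<dots> < length_T T q"
      using s(2) pos by simp
    finally have "fits K (set Q)"
      using unfit_min[of Q] by fastforce
    then show ?thesis
      using interior_subset unfolding fits_def Q_def by fastforce
  qed
  then obtain \<tau> where \<tau>: "\<And>k i. i < m \<Longrightarrow> s k *\<^sub>R (q ! i) - \<tau> k \<in> K"
    by metis
  define \<kappa> where "\<kappa> k = s k *\<^sub>R (q ! 0) - \<tau> k" for k
  have "\<kappa> k \<in> K" for k
    using \<tau>[OF \<open>0 < m\<close>] by (simp add: \<kappa>_def)
  then obtain l r where "l \<in> K" and r: "strict_mono r" "(\<kappa> \<circ> r) \<longlonglongrightarrow> l"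
    using K unfolding compact_def by blast
  have "s \<longlonglongrightarrow> 1 - 0"
    unfolding s_def by (intro tendsto_intros LIMSEQ_inverse_real_of_nat)
  then have s_lim: "(s \<circ> r) \<longlonglongrightarrow> 1"
    using LIMSEQ_subseq_LIMSEQ[OF _ r(1)] by simp
  have "q ! i - (q ! 0 - l) \<in> K" if "i < m" for i
  proof -
    have "(s \<circ> r) k *\<^sub>R (q ! i - q ! 0) + (\<kappa> \<circ> r) k \<in> K" for k
      using \<tau>[OF that, of "r k"] by (simp add: \<kappa>_def algebra_simps)
    moreover have "(\<lambda>k. (s \<circ> r) k *\<^sub>R (q ! i - q ! 0) + (\<kappa> \<circ> r) k)
        \<longlonglongrightarrow> 1 *\<^sub>R (q ! i - q ! 0) + l"
      by (intro tendsto_intros s_lim r(2))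
    ultimately have "1 *\<^sub>R (q ! i - q ! 0) + l \<in> K"
      by (rule closed_sequentially[OF compact_imp_closed[OF K]])
    then show ?thesis
      by (simp add: algebra_simps)
  qed
  then show ?thesis
    by (intro exI[of _ "q ! 0 - l"]) (auto simp: set_conv_nth m_def)
qed

text \<open>
  A certificate \<open>f\<close> for \<open>q\<close> plays two roles.  Since a translate of \<open>q\<close> lies in \<open>K\<close>, the functional
  \<open>f i\<close> is an outer normal of \<open>K\<close> at the translated vertex \<open>i\<close>.  And since every polygon \<open>g\<close> with
  \<open>(\<Sum>i<m. f i \<bullet> q ! i) \<le> (\<Sum>i<m. f i \<bullet> g i)\<close> inherits the certificate, \<open>q\<close> is shortest in a
  half-space of polygons, and the multiplier rule makes the momentum jump by a negative multiple
  of \<open>f i\<close> at vertex \<open>i\<close>.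
  No \<open>f i\<close> vanishes and no two consecutive vertices agree, because otherwise the vertex \<open>i\<close>
  could be removed.
\<close>

lemma translate_of_shortest_is_billiard_trajectory:
  assumes K: "convex_body K" and unfit: "\<not> fits K (set q)"
    and min: "\<And>q'. \<not> fits K (set q') \<Longrightarrow> length_T T q \<le> length_T T q'"
    and few: "\<And>q'. \<not> fits K (set q') \<Longrightarrow> length_T T q' \<le> length_T T q \<Longrightarrow> length q \<le> length q'"
  shows "\<exists>t. closed_billiard_trajectory K T (map (\<lambda>x. x - t) q)"
proof -
  have K': "convex K" "compact K" "interior K \<noteq> {}"
    using K by (auto simp: convex_body_def)
  define m where "m = length q"
  have m2: "2 \<le> m"
    using length_ge_2_if_not_fits[OF K'(3) unfit] by (simp add: m_def)
  have m: "m \<le> DIM('a) + 1"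
    using shorten_to_dim_plus_one[OF K'(1) unfit] few by (fastforce simp: m_def)
  have fits_without: "fits K ((!) q ` ({..<m} - {j}))" if j: "j < m" for j
  proof -
    define q' where "q' = take j q @ drop (Suc j) q"
    have "length q' < m"
      using j by (simp add: q'_def m_def)
    moreover have "length_T T q' \<le> length_T T q"
      using length_T_remove[of "take j q" "drop (Suc j) q" "q ! j"] j
      by (simp add: q'_def m_def flip: id_take_nth_drop)
    ultimately have "fits K (set q')"
      using few[of q'] by (auto simp: m_def)
    moreover have "q ! i \<in> set q'" if "i < m" "i \<noteq> j" for i
    proof (cases "i < j")
      case True
      then have "take j q ! i \<in> set (take j q)"
        using that(1) by (intro nth_mem) (simp add: m_def)
      then show ?thesis
        using True by (simp add: q'_def)
    next
      case False
      then have "drop (Suc j) q ! (i - Suc j) \<in> set (drop (Suc j) q)"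
        using that by (intro nth_mem) (simp add: m_def)
      then show ?thesis
        using False that by (simp add: q'_def m_def)
    qed
    ultimately show ?thesis
      using fits_mono[of K "set q'" "(!) q ` ({..<m} - {j})"] by auto
  qed
  have distinct_next: "q ! (Suc i mod m) \<noteq> q ! i" if i: "i < m" for i
  proof
    assume eq: "q ! (Suc i mod m) = q ! i"
    have "Suc i mod m \<noteq> i"
      using i m2 by (cases "Suc i = m") auto
    then have "q ! i \<in> (!) q ` ({..<m} - {i})"
      using eq m2 by (intro image_eqI[of _ _ "Suc i mod m"]) auto
    then have "set q \<subseteq> (!) q ` ({..<m} - {i})"
      by (auto simp: set_conv_nth m_def)
    then show False
      using fits_without[OF i] unfit fits_mono by blast
  qed
  have L: "length_T T q = polygon_length m ((!) q)"
    by (simp add: length_T_eq_polygon_length m_def)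
  have L_pos: "0 < polygon_length m ((!) q)"
    using m2 distinct_next[of 0] by (intro polygon_length_pos[of 0]) auto
  obtain t where t: "\<And>i. i < m \<Longrightarrow> q ! i - t \<in> K"
    using shortest_fits_in_translate[of K q] K'(2) min L L_pos m2 by (force simp: m_def)
  obtain f where f_sum: "(\<Sum>i<m. f i) = 0" and f_ex: "\<exists>i<m. f i \<noteq> 0"
    and f_max: "\<And>k. (\<And>i. i < m \<Longrightarrow> k i \<in> K) \<Longrightarrow> (\<Sum>i<m. f i \<bullet> k i) \<le> (\<Sum>i<m. f i \<bullet> q ! i)"
    using certificate_if_not_fits[OF K'(1,3) m, of "(!) q"] unfit
    by (auto simp: set_eq_nth_image m_def)
  have unfit_if: "\<not> fits K (g ` {i. i < m \<and> f i \<noteq> 0})"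
    if "(\<Sum>i<m. f i \<bullet> q ! i) \<le> (\<Sum>i<m. f i \<bullet> g i)" for g
    using not_fits_if_certificate[OF K'(3) f_sum f_ex, of g] f_max that by (meson order_trans)
  have f_nz: "f j \<noteq> 0" if j: "j < m" for j
  proof
    assume "f j = 0"
    then have "(!) q ` {i. i < m \<and> f i \<noteq> 0} \<subseteq> (!) q ` ({..<m} - {j})"
      by auto
    then show False
      using unfit_if[of "(!) q"] fits_without[OF j] fits_mono by blast
  qed
  have f_normal: "f j \<bullet> k \<le> f j \<bullet> (q ! j - t)" if j: "j < m" "k \<in> K" for j k
  proof -
    define k' where "k' i = (if i = j then k else q ! i - t)" for i
    have "(\<Sum>i<m. f i \<bullet> k' i) \<le> (\<Sum>i<m. f i \<bullet> q ! i)"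
      using j t by (intro f_max) (auto simp: k'_def)
    also have "\<dots> = (\<Sum>i<m. f i \<bullet> (q ! i - t))"
      using f_sum by (simp add: inner_diff_right sum_subtractf flip: inner_sum_left)
    finally show ?thesis
      using j(1) by (simp add: sum.remove[of "{..<m}" j] k'_def)
  qed
  have "polygon_length m ((!) q) \<le> polygon_length m g"
    if le: "(\<Sum>i<m. f i \<bullet> q ! i) \<le> (\<Sum>i<m. f i \<bullet> g i)" for g
  proof -
    have "\<not> fits K (g ` {..<m})"
      using unfit_if[OF le] fits_mono[of K "g ` {..<m}" "g ` {i. i < m \<and> f i \<noteq> 0}"] by auto
    then show ?thesis
      using min[of "map g [0..<m]"] by (simp add: L length_T_map lessThan_atLeast0)
  qed
  then obtain c p where c: "0 \<le> c" "c * (\<Sum>i<m. f i \<bullet> q ! i) = polygon_length m ((!) q)"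
    and p: "\<And>i. p i \<in> T"
    and jump: "\<And>i. i < m \<Longrightarrow> p (Suc i mod m) - p i = - (c *\<^sub>R blinfun_inner_left (f i))"
    and momentum: "\<And>i. i < m \<Longrightarrow> blinfun_apply (p (Suc i mod m)) (q ! (Suc i mod m) - q ! i)
                  = norm_T T (q ! (Suc i mod m) - q ! i)"
    using lagrange_multiplier_momenta[OF m f_ex, of "(!) q"] by blast
  \<comment> \<open>The multiplier is the same at all vertices; it is positive because the length is.\<close>
  have "0 < c"
    using c L_pos by (cases "c = 0") auto
  define Q where "Q = map (\<lambda>x. x - t) q"
  define P where "P = map p [0..<m]"
  have len: "length Q = m" "length P = m"
    by (simp_all add: Q_def P_def m_def)
  have cyc_Q: "cyc Q i = q ! (i mod m) - t" and cyc_P: "cyc P i = p (i mod m)" for i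
    using m2 by (simp_all add: cyc_def Q_def P_def flip: m_def)
  have im: "i mod m < m" and next_mod: "Suc (i mod m) mod m = (i + 1) mod m" for i
    using m2 by (simp_all add: mod_Suc_eq)
  have Q_frontier: "q ! i - t \<in> frontier K" if i: "i < m" for i
  proof (rule linear_maximizer_in_frontier)
    show "linear ((\<bullet>) (f i))"
      by (simp add: bounded_linear.linear bounded_linear_inner_right)
    show "f i \<bullet> f i \<noteq> 0"
      using f_nz[OF i] by simp
  qed (use t f_normal i in auto)
  have P_frontier: "p j \<in> frontier T" if j: "j < m" for j
  proof -
    \<comment> \<open>\<open>p j\<close> is the momentum of the edge that ends at vertex \<open>j\<close> and starts at its predecessor.\<close>
    define i where "i = (j + m - 1) mod m"
    have i: "i < m" "Suc i mod m = j"
      using m2 j by (simp_all add: i_def mod_Suc_eq)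
    define v where "v = q ! j - q ! i"
    have "0 < norm_T T v"
      using distinct_next[OF i(1)] by (intro norm_T_pos) (simp add: v_def i)
    moreover have "blinfun_apply (p j) v = norm_T T v"
      using momentum[OF i(1)] by (simp add: v_def i)
    ultimately show ?thesis
      using p norm_T_ge
      by (intro linear_maximizer_in_frontier[of "\<lambda>p. blinfun_apply p v" "p j"])
        (auto intro!: bounded_linear.linear bounded_linear_intros)
  qed
  have "\<exists>l n. 0 < l \<and> is_outer_normal K (cyc Q i) n \<and> cyc P (i + 1) - cyc P i = - (l *\<^sub>R n)" for i
  proof -
    define N where "N = blinfun_inner_left (f (i mod m))"
    have "N \<noteq> 0"
      using norm_le_norm_blinfun_inner_left[of "f (i mod m)"] f_nz[OF im] by (auto simp: N_def)
    have "is_outer_normal K (cyc Q i) ((1 / norm N) *\<^sub>R N)"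
      unfolding is_outer_normal_def cyc_Q using \<open>N \<noteq> 0\<close> f_normal[OF im, of _ i]
      by (auto simp: N_def blinfun.scaleR_left inner_commute intro!: divide_right_mono)
    moreover have "cyc P (i + 1) - cyc P i = - ((c * norm N) *\<^sub>R ((1 / norm N) *\<^sub>R N))"
      unfolding cyc_P using jump[OF im, of i] \<open>N \<noteq> 0\<close> unfolding next_mod N_def by simp
    ultimately show ?thesis
      using \<open>0 < c\<close> \<open>N \<noteq> 0\<close> by (metis mult_pos_pos zero_less_norm_iff)
  qed
  moreover have "set Q \<subseteq> frontier K"
    using Q_frontier by (auto simp: Q_def set_conv_nth m_def)
  moreover have "set P \<subseteq> frontier T"
    using P_frontier by (auto simp: P_def)
  moreover have "cyc Q i \<noteq> cyc Q (i + 1)" for i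
    unfolding cyc_Q using distinct_next[OF im, of i] unfolding next_mod by auto
  moreover have "blinfun_apply (cyc P (i + 1)) (cyc Q (i + 1) - cyc Q i)
      = norm_T T (cyc Q (i + 1) - cyc Q i)" for i
    unfolding cyc_Q cyc_P using momentum[OF im, of i] unfolding next_mod by simp
  ultimately have "closed_billiard_trajectory K T Q"
    unfolding closed_billiard_trajectory_def using m2 len by blast
  then show ?thesis
    unfolding Q_def by blast
qed

lemma length_T_translate: "length_T T (map (\<lambda>x. x - t) q) = length_T T q"
proof -
  have "length_T T (map (\<lambda>x. x - t) q) = polygon_length (length q) (\<lambda>i. q ! i - t)"
    unfolding length_T_eq_polygon_length length_map by (rule polygon_length_cong) simp
  then show ?thesis
    by (simp add: polygon_length_translate length_T_eq_polygon_length)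
qed

end

theorem theorem2p1:
  fixes K :: "'a::euclidean_space set" and T :: "('a \<Rightarrow>\<^sub>L real) set"
  assumes "smooth_convex_body K"
    and "smooth_convex_body T"
    and "0 \<in> interior T"
  shows "xi T K = (INF m\<in>{1..}. min_length T K m)
    \<and> (\<exists>Q. closed_billiard_trajectory K T Q \<and> ereal (length_T T Q) = xi T K)
    \<and> (\<forall>m\<ge>1. P_set m K \<noteq> {} \<longrightarrow> (\<exists>P\<in>P_set m K. ereal (length_T T P) = min_length T K m))
    \<and> (\<exists>m\<in>{1..DIM('a) + 1}. \<exists>P\<in>P_set m K.
          ereal (length_T T P) = (INF m\<in>{1..}. min_length T K m))"
proof -
  have K: "convex_body K"
    using assms(1) by (simp add: smooth_convex_body_def)
  then have K': "convex K" "interior K \<noteq> {}"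
    by (auto simp: convex_body_def)
  interpret momentum_body T
    using assms(2,3) by unfold_locales (auto simp: smooth_convex_body_def convex_body_def)
  obtain q where q: "\<not> fits K (set q)"
    and min: "\<And>q'. \<not> fits K (set q') \<Longrightarrow> length_T T q \<le> length_T T q'"
    and few: "\<And>q'. \<not> fits K (set q') \<Longrightarrow> length_T T q' \<le> length_T T q \<Longrightarrow> length q \<le> length q'"
    using shortest_with_fewest_vertices_exists[OF K] by blast
  obtain t where Q: "closed_billiard_trajectory K T (map (\<lambda>x. x - t) q)"
    using translate_of_shortest_is_billiard_trajectory[OF K q min few] by blast
  have q_len: "1 \<le> length q" "length q \<le> DIM('a) + 1"
    using length_ge_2_if_not_fits[OF K'(2) q] shorten_to_dim_plus_one[OF K'(1) q] few by force+
  have q_P: "q \<in> P_set (length q) K"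
    using q by (simp add: P_set_iff[OF K])
  have xi: "xi T K = ereal (length_T T q)"
    unfolding xi_def
  proof (rule antisym)
    show "(INF Q\<in>{Q. closed_billiard_trajectory K T Q}. ereal (length_T T Q)) \<le> ereal (length_T T q)"
      using Q by (intro INF_lower2[of "map (\<lambda>x. x - t) q"]) (auto simp: length_T_translate)
    show "ereal (length_T T q) \<le> (INF Q\<in>{Q. closed_billiard_trajectory K T Q}. ereal (length_T T Q))"
      using min billiard_trajectory_not_fits[OF K'(2)] by (intro INF_greatest) auto
  qed
  have inf: "(INF m\<in>{1..}. min_length T K m) = ereal (length_T T q)"
    unfolding min_length_def
  proof (rule antisym)
    show "(INF m\<in>{1..}. INF P\<in>P_set m K. ereal (length_T T P)) \<le> ereal (length_T T q)"
      using q_len q_P by (intro INF_lower2[of "length q"] INF_lower2[of q]) auto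
    show "ereal (length_T T q) \<le> (INF m\<in>{1..}. INF P\<in>P_set m K. ereal (length_T T P))"
      using min by (intro INF_greatest) (auto simp: P_set_iff[OF K])
  qed
  have attained: "\<exists>P\<in>P_set m K. ereal (length_T T P) = min_length T K m" if ne: "P_set m K \<noteq> {}" for m
  proof -
    obtain P where P: "P \<in> P_set m K" "\<And>P'. P' \<in> P_set m K \<Longrightarrow> length_T T P \<le> length_T T P'"
      using shortest_in_P_set_exists[OF K ne] by blast
    then have "ereal (length_T T P) = min_length T K m"
      unfolding min_length_def by (intro antisym INF_greatest INF_lower) auto
    with P(1) show ?thesis
      by blast
  qed
  show ?thesis
    unfolding inf xi
  proof (intro conjI)
    show "\<exists>Q. closed_billiard_trajectory K T Q \<and> ereal (length_T T Q) = ereal (length_T T q)"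
      using Q length_T_translate by blast
    show "\<exists>m\<in>{1..DIM('a) + 1}. \<exists>P\<in>P_set m K. ereal (length_T T P) = ereal (length_T T q)"
      using q_len q_P by (intro bexI[of _ "length q"] bexI[of _ q]) auto
  qed (use attained in auto)
qed

end
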